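(* Let $\sigma$ be a module ordering on $\mathbb{T}^n\langle e_1,\dots,e_r\rangle$ and let $\overline{\sigma}$ be its extension by $W$. Let $U_1,\dots,U_s$ be homogeneous vectors in $\overline{F}$ and let $N$ be the graded submodule of $\overline F$ generated by $\{U_1,\dots,U_s\}$. (1) Every Weak Self-Saturating Buchberger's Algorithm applied to $(U_1,\dots,U_s)$ computes a $\sigma$-DehomBasis for $N$. (2) The Self-Saturating Buchberger's Algorithm applied to $(U_1,\dots,U_s)$ computes a $\overline{\sigma}$-SatGBasis for $N$.
   Context: Setting. $K$ is a field, $P=K[x_1,\dots,x_n]$, $W\in\mathrm{Mat}_{m,n}(\mathbb{Z})$ is a matrix of rank $m\ge 1$, and $\overline{P}=K[y_1,\dots,y_m,x_1,\dots,x_n]$ is graded by $\overline{W}=(I_m\mid W)$, i.e. $\deg_{\overline W}(y_i)$ is the $i$-th standard basis vector of $\mathbb{Z}^m$ and $\deg_{\overline W}(x_j)$ is the $j$-th column of $W$. $\mathbb{T}^n$ and $\mathbb{T}^{m+n}$ are the monoids of power products of $P$ and $\overline{P}$. $F=P^r$ has canonical basis $e_1,\dots,e_r$; $\delta_1,\dots,\delta_r\in\mathbb{Z}^m$ are fixed and $\overline{F}=\bigoplus_{i=1}^r\overline{P}(-\delta_i)$, so $\deg(te_i)=\deg(t)+\delta_i$. The sets of terms $te_i$ of $F$ and of $\overline F$ are denoted $\mathbb{T}^n\langle e_1,\dots,e_r\rangle$ and $\mathbb{T}^{m+n}\langle e_1,\dots,e_r\rangle$. $\mathbb{Z}^m$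 is ordered lexicographically. Orderings. A module ordering on a set of terms is a total ordering compatible with multiplication by power products and compatible with a monoid ordering $\tau$ on power products ($t_1>_\tau t_2$ implies $t_1e_i>t_2e_i$). The extension $\overline{\sigma}$ of $\sigma$ by $W$ is the ordering on $\mathbb{T}^{m+n}\langle e_1,\dots,e_r\rangle$ given by: $t_1e_i>_{\overline\sigma}t_2e_j$ iff $\deg_{\overline W}(t_1e_i)>\deg_{\overline W}(t_2e_j)$, or these degrees are equal and $t_1^{\rm deh}e_i>_\sigma t_2^{\rm deh}e_j$. LT denotes the leading term. A $\sigma$-Gröbner basis (resp. $\overline\sigma$-Gröbner basis) of a module is a set of non-zero elements of it whose leading terms generate the module generated by all leading terms of its non-zero elements. Homogenization. For $V\in\overline F$, $V^{\rm deh}\in F$ is obtained by setting $y_1=\dots=y_m=1$ (likewise for power products). For $0\ne v=\sum_j c_jt_je_{i_j}\in F$ (distinct terms, $c_j\neq0$), let $\mu\in\mathbb{Z}^m$ be the componentwise maximum of the $\deg_W(t_je_{i_j})$; then $v^{\rm hom}=\sum_j c_j\,y^{\mu-\deg_W(t_je_{i_j})}t_je_{i_j}\in\overline F$, and $0^{\rm hom}=0$. For a submodule $M\subseteq F$, $M^{\rm hom}=\langle v^{\rm hom}\mid v\in M\rangle\subseteq\overline F$; for a graded submodule $N\subseteq\overline F$, $N^{\rm deh}=\{V^{\rm deh}\mid V\in N\}$. For homogeneous $U\in\overline F$, the saturation of $U$ is $U^{\rm sat}=(U^{\rm deh})^{\rm hom}$, and $N^{\rm sat}=(N^{\rm deh})^{\rm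 hom}$. Bases. Let $N$ be a graded submodule of $\overline F$ and let $V_1,\dots,V_t\in N$ be non-zero homogeneous vectors. The set $\{V_1,\dots,V_t\}$ is called a $\overline\sigma$-SatGBasis for $N$ if it is a $\overline\sigma$-Gröbner basis of a graded submodule $\tilde N$ of $\overline F$ such that $\tilde N^{\rm sat}=N^{\rm sat}$. It is called a $\sigma$-DehomBasis for $N$ if $\{V_1^{\rm deh},\dots,V_t^{\rm deh}\}$ is a $\sigma$-Gröbner basis of $N^{\rm deh}$. Algorithms. If $U,V$ have leading monomials $c_Ut_Ue_i$, $c_Vt_Ve_i$, then $S(U,V)=\frac{\mathrm{lcm}(t_U,t_V)}{c_Ut_U}U-\frac{\mathrm{lcm}(t_U,t_V)}{c_Vt_V}V$ (pairs whose leading terms lie in different components are ignored). A remainder of $Q$ by $\mathcal G$ is an output of the division algorithm (repeatedly subtracting multiples $c\,t\,V$, $V\in\mathcal G$, $c\in K$, $t$ a power product, cancelling a term of the current vector), ending with a vector that is zero or has leading term not divisible by $\mathrm{LT}(V)$ for any $V\in\mathcal G$. A weak saturating remainder of a homogeneous $Q$ by a tuple $\mathcal G$ of homogeneous vectors is obtained in the same way, except that at each step the current vector may be replaced by any homogeneous vector with the same saturation. A saturating remainder of $Q$ by $\mathcal G$ is $R^{\rm sat}$ where $R$ is a remainder of $Q$ by $\mathcal G$. Buchberger's Algorithm applied to $u_1,\dots,u_s$: (1) set Pairs $=\emptyset$, Gens $=(u_1,\dots,u_s)$, $\mathcal G=\emptyset$. (2) While Gens $\neq\emptyset$ or Pairs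 $\neq\emptyset$: (2a) choose $Q\in$ Gens and remove it from Gens, or choose $(V_i,V_j)\in$ Pairs, remove it from Pairs and let $Q=S(V_i,V_j)$; (2b) compute a remainder $V$ of $Q$ by $\mathcal G$; (2c) if $V\ne0$, add $V$ to $\mathcal G$ and the pairs of $V$ with all previous elements of $\mathcal G$ to Pairs. (3) Return $\mathcal G$. All choices are arbitrary. A Weak Self-Saturating Buchberger's Algorithm is this procedure on homogeneous vectors of $\overline F$ with respect to $\overline\sigma$, where in (2b) $V$ is instead a weak saturating remainder of $Q$ by $\mathcal G$; the Self-Saturating Buchberger's Algorithm is the special case where in (2b) $V$ is a saturating remainder of $Q$ by $\mathcal G$.
   Formalization: Basis elements are required to lie in N^sat rather than N (for W=(1), N=⟨yx⟩ the algorithm returns x, not in N); "computes" means the main loop always ends and every output is correct, with remainders proved to exist when σ is a well-ordering. *)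

theory Defs
  imports "HOL-Analysis.Analysis" "HOL-Library.Poly_Mapping" "HOL-Library.Fun_Lexorder"
    "HOL-Library.Multiset"
begin

text \<open>
  Power products in the indeterminates \<open>'v\<close> are finitely supported exponent functions, written
  additively.  Polynomials over \<open>'k\<close> are finitely supported functions on power products (the
  library provides their commutative ring structure), free modules are \<open>vec\<close> types over the
  polynomial ring, and the term \<open>t e\<^sub>i\<close> is the pair \<open>(t, i)\<close>.  The indeterminates of the
  extended ring are indexed by \<open>'m + 'n\<close>: \<open>Inl i\<close> stands for \<open>y\<^sub>i\<close> and \<open>Inr j\<close> for \<open>x\<^sub>j\<close>.
\<close>

type_synonym 'v pp = "'v \<Rightarrow>\<^sub>0 nat"
type_synonym ('v, 'r) trm = "'v pp \<times> 'r"
type_synonym 'm zvec = "(int, 'm) vec"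
type_synonym ('m, 'n) zmat = "('n zvec, 'm) vec"
type_synonym ('k, 'v, 'r) fmod = "('v pp \<Rightarrow>\<^sub>0 'k, 'r) vec"

global_interpretation fmod: module "(*s) :: 'a::comm_ring_1 \<Rightarrow> 'a ^ 'r \<Rightarrow> 'a ^ 'r"
  by unfold_locales (simp_all add: vec_eq_iff algebra_simps)


subsection \<open>Terms and orderings\<close>

definition coeff :: "('k::zero, 'v, 'r::finite) fmod \<Rightarrow> ('v, 'r) trm \<Rightarrow> 'k" where
  "coeff v u = Poly_Mapping.lookup (v $ snd u) (fst u)"

definition supp :: "('k::zero, 'v, 'r::finite) fmod \<Rightarrow> ('v, 'r) trm set" where
  "supp v = {u. coeff v u \<noteq> 0}"

definition term_vec :: "('v, 'r) trm \<Rightarrow> ('k::zero_neq_one, 'v, 'r::finite) fmod" where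
  "term_vec u = axis (snd u) (Poly_Mapping.single (fst u) 1)"

definition term_mult :: "'v pp \<Rightarrow> ('v, 'r) trm \<Rightarrow> ('v, 'r) trm" where
  "term_mult t u = (t + fst u, snd u)"

definition term_dvd :: "('v, 'r) trm \<Rightarrow> ('v, 'r) trm \<Rightarrow> bool" where
  "term_dvd u w \<longleftrightarrow> (\<exists>t. w = term_mult t u)"

lift_definition pp_lcm :: "'v pp \<Rightarrow> 'v pp \<Rightarrow> 'v pp" is "\<lambda>s t j. max (s j) (t j)"
  subgoal for s t by (rule finite_subset[of _ "{j. s j \<noteq> 0} \<union> {j. t j \<noteq> 0}"]) (auto simp: max_def)
  done

text \<open>
  Orderings are given by their strict part: \<open>\<sigma> u w\<close> means that \<open>u\<close> is smaller than \<open>w\<close>.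
  Neither a monoid ordering nor a module ordering is required to be a well-ordering.
\<close>

definition monoid_ordering :: "('v pp \<Rightarrow> 'v pp \<Rightarrow> bool) \<Rightarrow> bool" where
  "monoid_ordering \<tau> \<longleftrightarrow> irreflp \<tau> \<and> transp \<tau> \<and> totalp \<tau> \<and>
     (\<forall>s t1 t2. \<tau> t1 t2 \<longrightarrow> \<tau> (s + t1) (s + t2))"

definition module_ordering :: "(('v, 'r) trm \<Rightarrow> ('v, 'r) trm \<Rightarrow> bool) \<Rightarrow> bool" where
  "module_ordering \<sigma> \<longleftrightarrow> irreflp \<sigma> \<and> transp \<sigma> \<and> totalp \<sigma> \<and>
     (\<forall>s u w. \<sigma> u w \<longrightarrow> \<sigma> (term_mult s u) (term_mult s w)) \<and>
     (\<exists>\<tau>. monoid_ordering \<tau> \<and> (\<forall>t1 t2 i. \<tau> t1 t2 \<longrightarrow> \<sigma> (t1, i) (t2, i)))"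

text \<open>Leading term and leading coefficient are meaningful for non-zero vectors only.\<close>

definition LT :: "(('v, 'r) trm \<Rightarrow> ('v, 'r) trm \<Rightarrow> bool) \<Rightarrow> ('k::zero, 'v, 'r::finite) fmod
    \<Rightarrow> ('v, 'r) trm" where
  "LT \<sigma> v = (THE u. u \<in> supp v \<and> (\<forall>w\<in>supp v. w \<noteq> u \<longrightarrow> \<sigma> w u))"

definition LC :: "(('v, 'r) trm \<Rightarrow> ('v, 'r) trm \<Rightarrow> bool) \<Rightarrow> ('k::zero, 'v, 'r::finite) fmod
    \<Rightarrow> 'k" where
  "LC \<sigma> v = coeff v (LT \<sigma> v)"

definition groebner_basis :: "(('v, 'r) trm \<Rightarrow> ('v, 'r) trm \<Rightarrow> bool)
    \<Rightarrow> ('k::field, 'v, 'r::finite) fmod set \<Rightarrow> ('k, 'v, 'r) fmod set \<Rightarrow> bool" where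
  "groebner_basis \<sigma> G M \<longleftrightarrow> G \<subseteq> M - {0} \<and>
     fmod.span ((\<lambda>v. term_vec (LT \<sigma> v) :: ('k, 'v, 'r) fmod) ` G) =
     fmod.span ((\<lambda>v. term_vec (LT \<sigma> v)) ` (M - {0}))"


subsection \<open>Gradings\<close>

definition tdeg :: "('m::finite, 'v::finite) zmat \<Rightarrow> ('r \<Rightarrow> 'm zvec) \<Rightarrow> ('v, 'r) trm \<Rightarrow> 'm zvec" where
  "tdeg A \<delta> u = A *v (\<chi> j. int (Poly_Mapping.lookup (fst u) j)) + \<delta> (snd u)"

text \<open>The block matrix \<open>(I\<^sub>m | W)\<close>.\<close>

definition ext_matrix :: "('m::finite, 'n::finite) zmat \<Rightarrow> ('m, 'm + 'n) zmat" where
  "ext_matrix W = (\<chi> i j. case j of Inl k \<Rightarrow> mat 1 $ i $ k | Inr l \<Rightarrow> W $ i $ l)"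

definition homogeneous :: "('m::finite, 'v::finite) zmat \<Rightarrow> ('r \<Rightarrow> 'm zvec)
    \<Rightarrow> ('k::zero, 'v, 'r::finite) fmod \<Rightarrow> bool" where
  "homogeneous A \<delta> v \<longleftrightarrow> (\<exists>d. \<forall>u\<in>supp v. tdeg A \<delta> u = d)"

definition hom_component :: "('m::finite, 'v::finite) zmat \<Rightarrow> ('r \<Rightarrow> 'm zvec) \<Rightarrow> 'm zvec
    \<Rightarrow> ('k::zero, 'v, 'r::finite) fmod \<Rightarrow> ('k, 'v, 'r) fmod" where
  "hom_component A \<delta> d v =
     (\<chi> i. Poly_Mapping.mapp (\<lambda>t c. if tdeg A \<delta> (t, i) = d then c else 0) (v $ i))"

definition graded_submodule :: "('m::finite, 'v::finite) zmat \<Rightarrow> ('r \<Rightarrow> 'm zvec)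
    \<Rightarrow> ('k::field, 'v, 'r::finite) fmod set \<Rightarrow> bool" where
  "graded_submodule A \<delta> N \<longleftrightarrow> fmod.subspace N \<and> (\<forall>v\<in>N. \<forall>d. hom_component A \<delta> d v \<in> N)"


subsection \<open>Homogenization, dehomogenization, saturation\<close>

definition deh_term :: "('m + 'n, 'r) trm \<Rightarrow> ('n, 'r) trm" where
  "deh_term u = (Poly_Mapping.map_key Inr (fst u), snd u)"

definition deh :: "('k::comm_ring_1, 'm + 'n, 'r::finite) fmod \<Rightarrow> ('k, 'n, 'r) fmod" where
  "deh V = (\<Sum>u\<in>supp V. axis (snd u) (Poly_Mapping.single (fst (deh_term u)) (coeff V u)))"

text \<open>The power product \<open>y\<^sup>a t\<close>, for an exponent vector \<open>a\<close> with non-negative entries.\<close>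

definition y_times :: "'m::finite zvec \<Rightarrow> 'n::finite pp \<Rightarrow> ('m + 'n) pp" where
  "y_times a t = Abs_poly_mapping (case_sum (\<lambda>k. nat (a $ k)) (Poly_Mapping.lookup t))"

definition top_deg :: "('m::finite, 'n::finite) zmat \<Rightarrow> ('r \<Rightarrow> 'm zvec)
    \<Rightarrow> ('k::zero, 'n, 'r::finite) fmod \<Rightarrow> 'm zvec" where
  "top_deg W \<delta> v = (\<chi> k. Max ((\<lambda>u. tdeg W \<delta> u $ k) ` supp v))"

definition homog :: "('m::finite, 'n::finite) zmat \<Rightarrow> ('r \<Rightarrow> 'm zvec)
    \<Rightarrow> ('k::comm_ring_1, 'n, 'r::finite) fmod \<Rightarrow> ('k, 'm + 'n, 'r) fmod" where
  "homog W \<delta> v = (\<Sum>u\<in>supp v. axis (snd u)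
     (Poly_Mapping.single (y_times (top_deg W \<delta> v - tdeg W \<delta> u) (fst u)) (coeff v u)))"

definition homog_module :: "('m::finite, 'n::finite) zmat \<Rightarrow> ('r \<Rightarrow> 'm zvec)
    \<Rightarrow> ('k::field, 'n, 'r::finite) fmod set \<Rightarrow> ('k, 'm + 'n, 'r) fmod set" where
  "homog_module W \<delta> M = fmod.span (homog W \<delta> ` M)"

definition saturation :: "('m::finite, 'n::finite) zmat \<Rightarrow> ('r \<Rightarrow> 'm zvec)
    \<Rightarrow> ('k::field, 'm + 'n, 'r::finite) fmod \<Rightarrow> ('k, 'm + 'n, 'r) fmod" where
  "saturation W \<delta> U = homog W \<delta> (deh U)"

definition module_saturation :: "('m::finite, 'n::finite) zmat \<Rightarrow> ('r \<Rightarrow> 'm zvec)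
    \<Rightarrow> ('k::field, 'm + 'n, 'r::finite) fmod set \<Rightarrow> ('k, 'm + 'n, 'r) fmod set" where
  "module_saturation W \<delta> N = homog_module W \<delta> (deh ` N)"

text \<open>The order on \<open>vec\<close> in the library is componentwise, hence the explicit lexicographic one.\<close>

definition ext_ordering :: "('m::{finite,linorder}, 'n::finite) zmat \<Rightarrow> ('r \<Rightarrow> 'm zvec)
    \<Rightarrow> (('n, 'r) trm \<Rightarrow> ('n, 'r) trm \<Rightarrow> bool)
    \<Rightarrow> ('m + 'n, 'r) trm \<Rightarrow> ('m + 'n, 'r) trm \<Rightarrow> bool" where
  "ext_ordering W \<delta> \<sigma> u w \<longleftrightarrow>
     less_fun (($) (tdeg (ext_matrix W) \<delta> u)) (($) (tdeg (ext_matrix W) \<delta> w)) \<or>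
     tdeg (ext_matrix W) \<delta> u = tdeg (ext_matrix W) \<delta> w \<and> \<sigma> (deh_term u) (deh_term w)"


subsection \<open>Bases\<close>

text \<open>
  The members of a SatGBasis or of a DehomBasis for \<open>N\<close> are taken in the saturation of \<open>N\<close>, not
  in \<open>N\<close> itself, because the algorithms replace vectors of \<open>N\<close> by their saturations: for
  \<open>m = n = r = 1\<close>, \<open>W = (1)\<close> and \<open>N = \<langle>y x\<rangle>\<close> the Self-Saturating Buchberger's Algorithm
  returns \<open>x\<close>, which is not in \<open>N\<close>.
\<close>

definition SatGBasis :: "('m::{finite,linorder}, 'n::finite) zmat \<Rightarrow> ('r \<Rightarrow> 'm zvec)
    \<Rightarrow> (('n, 'r) trm \<Rightarrow> ('n, 'r) trm \<Rightarrow> bool)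
    \<Rightarrow> ('k::field, 'm + 'n, 'r::finite) fmod set
    \<Rightarrow> ('k, 'm + 'n, 'r) fmod set \<Rightarrow> bool" where
  "SatGBasis W \<delta> \<sigma> G N \<longleftrightarrow>
     finite G \<and> G \<subseteq> module_saturation W \<delta> N - {0} \<and>
     (\<forall>V\<in>G. homogeneous (ext_matrix W) \<delta> V) \<and>
     (\<exists>N'. graded_submodule (ext_matrix W) \<delta> N' \<and>
        groebner_basis (ext_ordering W \<delta> \<sigma>) G N' \<and>
        module_saturation W \<delta> N' = module_saturation W \<delta> N)"

definition DehomBasis :: "('m::finite, 'n::finite) zmat \<Rightarrow> ('r \<Rightarrow> 'm zvec)
    \<Rightarrow> (('n, 'r) trm \<Rightarrow> ('n, 'r) trm \<Rightarrow> bool)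
    \<Rightarrow> ('k::field, 'm + 'n, 'r::finite) fmod set
    \<Rightarrow> ('k, 'm + 'n, 'r) fmod set \<Rightarrow> bool" where
  "DehomBasis W \<delta> \<sigma> G N \<longleftrightarrow>
     finite G \<and> G \<subseteq> module_saturation W \<delta> N - {0} \<and>
     (\<forall>V\<in>G. homogeneous (ext_matrix W) \<delta> V) \<and>
     groebner_basis \<sigma> (deh ` G) (deh ` N)"


subsection \<open>Remainders\<close>

text \<open>
  One division step; the term of the current vector that is cancelled is the leading term of the
  subtracted multiple.
\<close>

definition reduces :: "(('v, 'r) trm \<Rightarrow> ('v, 'r) trm \<Rightarrow> bool)
    \<Rightarrow> ('k::field, 'v, 'r::finite) fmod list
    \<Rightarrow> ('k, 'v, 'r) fmod \<Rightarrow> ('k, 'v, 'r) fmod \<Rightarrow> bool" where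
  "reduces \<sigma> G Q R \<longleftrightarrow> (\<exists>V\<in>set G. V \<noteq> 0 \<and> (\<exists>c t.
     R = Q - Poly_Mapping.single t c *s V \<and>
     term_mult t (LT \<sigma> V) \<in> supp Q \<and> term_mult t (LT \<sigma> V) \<notin> supp R))"

definition lead_irreducible :: "(('v, 'r) trm \<Rightarrow> ('v, 'r) trm \<Rightarrow> bool)
    \<Rightarrow> ('k::field, 'v, 'r::finite) fmod list \<Rightarrow> ('k, 'v, 'r) fmod \<Rightarrow> bool" where
  "lead_irreducible \<sigma> G R \<longleftrightarrow>
     R = 0 \<or> (\<forall>V\<in>set G. V \<noteq> 0 \<longrightarrow> \<not> term_dvd (LT \<sigma> V) (LT \<sigma> R))"

definition remainder :: "(('v, 'r) trm \<Rightarrow> ('v, 'r) trm \<Rightarrow> bool)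
    \<Rightarrow> ('k::field, 'v, 'r::finite) fmod list
    \<Rightarrow> ('k, 'v, 'r) fmod \<Rightarrow> ('k, 'v, 'r) fmod \<Rightarrow> bool" where
  "remainder \<sigma> G Q R \<longleftrightarrow> (reduces \<sigma> G)\<^sup>*\<^sup>* Q R \<and> lead_irreducible \<sigma> G R"

definition weak_sat_step :: "('m::{finite,linorder}, 'n::finite) zmat \<Rightarrow> ('r \<Rightarrow> 'm zvec)
    \<Rightarrow> (('n, 'r) trm \<Rightarrow> ('n, 'r) trm \<Rightarrow> bool)
    \<Rightarrow> ('k::field, 'm + 'n, 'r::finite) fmod list
    \<Rightarrow> ('k, 'm + 'n, 'r) fmod \<Rightarrow> ('k, 'm + 'n, 'r) fmod \<Rightarrow> bool" where
  "weak_sat_step W \<delta> \<sigma> G Q R \<longleftrightarrow> reduces (ext_ordering W \<delta> \<sigma>) G Q R \<or>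
     homogeneous (ext_matrix W) \<delta> R \<and> saturation W \<delta> R = saturation W \<delta> Q"

definition weak_sat_remainder :: "('m::{finite,linorder}, 'n::finite) zmat \<Rightarrow> ('r \<Rightarrow> 'm zvec)
    \<Rightarrow> (('n, 'r) trm \<Rightarrow> ('n, 'r) trm \<Rightarrow> bool)
    \<Rightarrow> ('k::field, 'm + 'n, 'r::finite) fmod list
    \<Rightarrow> ('k, 'm + 'n, 'r) fmod \<Rightarrow> ('k, 'm + 'n, 'r) fmod \<Rightarrow> bool" where
  "weak_sat_remainder W \<delta> \<sigma> G Q V \<longleftrightarrow>
     (weak_sat_step W \<delta> \<sigma> G)\<^sup>*\<^sup>* Q V \<and> lead_irreducible (ext_ordering W \<delta> \<sigma>) G V"

definition sat_remainder :: "('m::{finite,linorder}, 'n::finite) zmat \<Rightarrow> ('r \<Rightarrow> 'm zvec)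
    \<Rightarrow> (('n, 'r) trm \<Rightarrow> ('n, 'r) trm \<Rightarrow> bool)
    \<Rightarrow> ('k::field, 'm + 'n, 'r::finite) fmod list
    \<Rightarrow> ('k, 'm + 'n, 'r) fmod \<Rightarrow> ('k, 'm + 'n, 'r) fmod \<Rightarrow> bool" where
  "sat_remainder W \<delta> \<sigma> G Q V \<longleftrightarrow>
     (\<exists>R. remainder (ext_ordering W \<delta> \<sigma>) G Q R \<and> V = saturation W \<delta> R)"


subsection \<open>Buchberger's algorithm\<close>

definition S_vector :: "(('v, 'r) trm \<Rightarrow> ('v, 'r) trm \<Rightarrow> bool)
    \<Rightarrow> ('k::field, 'v, 'r::finite) fmod \<Rightarrow> ('k, 'v, 'r) fmod \<Rightarrow> ('k, 'v, 'r) fmod" where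
  "S_vector \<sigma> U V =
     (let tU = fst (LT \<sigma> U); tV = fst (LT \<sigma> V); l = pp_lcm tU tV in
      Poly_Mapping.single (l - tU) (1 / LC \<sigma> U) *s U -
      Poly_Mapping.single (l - tV) (1 / LC \<sigma> V) *s V)"

text \<open>
  A state consists of Gens, Pairs and the current tuple \<open>\<G>\<close>; a pair of vectors is represented
  by their positions in \<open>\<G>\<close>.  The predicate \<open>rem G Q V\<close> says which vectors \<open>V\<close> may be
  computed from \<open>Q\<close> and \<open>\<G>\<close>, so that all variants of the algorithm are instances.
\<close>

type_synonym ('k, 'v, 'r) bstate =
  "('k, 'v, 'r) fmod multiset \<times> (nat \<times> nat) set \<times> ('k, 'v, 'r) fmod list"

definition add_vector :: "(('v, 'r) trm \<Rightarrow> ('v, 'r) trm \<Rightarrow> bool)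
    \<Rightarrow> ('k::field, 'v, 'r::finite) fmod \<Rightarrow> ('k, 'v, 'r) bstate \<Rightarrow> ('k, 'v, 'r) bstate" where
  "add_vector \<sigma> V = (\<lambda>(gens, prs, G). if V = 0 then (gens, prs, G)
     else (gens, prs \<union> {(i, length G) | i. i < length G \<and> snd (LT \<sigma> (G ! i)) = snd (LT \<sigma> V)},
           G @ [V]))"

inductive buchberger_step :: "(('v, 'r) trm \<Rightarrow> ('v, 'r) trm \<Rightarrow> bool)
    \<Rightarrow> (('k::field, 'v, 'r::finite) fmod list \<Rightarrow> ('k, 'v, 'r) fmod \<Rightarrow> ('k, 'v, 'r) fmod \<Rightarrow> bool)
    \<Rightarrow> ('k, 'v, 'r) bstate \<Rightarrow> ('k, 'v, 'r) bstate \<Rightarrow> bool" for \<sigma> rem where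
  gens: "rem G Q V \<Longrightarrow>
    buchberger_step \<sigma> rem (add_mset Q gens, prs, G) (add_vector \<sigma> V (gens, prs, G))"
| pairs: "(i, j) \<in> prs \<Longrightarrow> rem G (S_vector \<sigma> (G ! i) (G ! j)) V \<Longrightarrow>
    buchberger_step \<sigma> rem (gens, prs, G) (add_vector \<sigma> V (gens, prs - {(i, j)}, G))"

definition buchberger_reaches :: "(('v, 'r) trm \<Rightarrow> ('v, 'r) trm \<Rightarrow> bool)
    \<Rightarrow> (('k::field, 'v, 'r::finite) fmod list \<Rightarrow> ('k, 'v, 'r) fmod \<Rightarrow> ('k, 'v, 'r) fmod \<Rightarrow> bool)
    \<Rightarrow> ('k, 'v, 'r) fmod list \<Rightarrow> ('k, 'v, 'r) bstate \<Rightarrow> bool" where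
  "buchberger_reaches \<sigma> rem Us s \<longleftrightarrow> (buchberger_step \<sigma> rem)\<^sup>*\<^sup>* (mset Us, {}, []) s"

text \<open>
  No choice whatsoever leads to infinitely many rounds, and whatever is returned satisfies
  \<open>P\<close>.  A run can still get stuck if no remainder exists, which may happen when the
  ordering is not a well-ordering; \<open>buchberger_progress\<close> excludes this.
\<close>

definition buchberger_computes :: "(('v, 'r) trm \<Rightarrow> ('v, 'r) trm \<Rightarrow> bool)
    \<Rightarrow> (('k::field, 'v, 'r::finite) fmod list \<Rightarrow> ('k, 'v, 'r) fmod \<Rightarrow> ('k, 'v, 'r) fmod \<Rightarrow> bool)
    \<Rightarrow> ('k, 'v, 'r) fmod list \<Rightarrow> (('k, 'v, 'r) fmod set \<Rightarrow> bool) \<Rightarrow> bool" where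
  "buchberger_computes \<sigma> rem Us P \<longleftrightarrow>
     (\<nexists>f. f 0 = (mset Us, {}, []) \<and> (\<forall>k::nat. buchberger_step \<sigma> rem (f k) (f (Suc k)))) \<and>
     (\<forall>G. buchberger_reaches \<sigma> rem Us ({#}, {}, G) \<longrightarrow> P (set G))"

definition buchberger_progress :: "(('v, 'r) trm \<Rightarrow> ('v, 'r) trm \<Rightarrow> bool)
    \<Rightarrow> (('k::field, 'v, 'r::finite) fmod list \<Rightarrow> ('k, 'v, 'r) fmod \<Rightarrow> ('k, 'v, 'r) fmod \<Rightarrow> bool)
    \<Rightarrow> ('k, 'v, 'r) fmod list \<Rightarrow> bool" where
  "buchberger_progress \<sigma> rem Us \<longleftrightarrow>
     (\<forall>gens prs G. buchberger_reaches \<sigma> rem Us (gens, prs, G) \<longrightarrow>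
        (\<forall>Q\<in>#gens. \<exists>V. rem G Q V) \<and>
        (\<forall>(i, j)\<in>prs. \<exists>V. rem G (S_vector \<sigma> (G ! i) (G ! j)) V))"

end

theory Submission
  imports Defs
begin

text \<open>
  On the terms of one fixed degree of the extended module, setting all \<open>y\<^sub>i\<close> to \<open>1\<close> is injective and turns
  \<open>\<sigma>\<close>-bar into \<open>\<sigma>\<close> (\<open>term_eq_of_degree_deh\<close>, \<open>ext_ordering_same_degree\<close>).  For homogeneous vectors,
  dehomogenization therefore commutes with leading terms (\<open>LT_deh\<close>) and with S-vectors
  (\<open>deh_S_vector\<close>), a division step becomes a division step by the dehomogenized vectors, and a
  replacement by a vector with the same saturation becomes invisible, since a vector is recovered
  from its homogenization (\<open>deh_homog\<close>).  Hence the module generated by the dehomogenizations of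
  Gens and \<open>\<G>\<close> never changes, and a pair \<open>(U, V)\<close> that has been treated leaves behind an expression
  of the S-vector of \<open>U\<^sup>d\<^sup>e\<^sup>h\<close> and \<open>V\<^sup>d\<^sup>e\<^sup>h\<close> by multiples of members of \<open>\<G>\<^sup>d\<^sup>e\<^sup>h\<close> with leading terms
  below the least common multiple (\<open>weak_sat_S_pair_lifts\<close>).  When no pair is left, Buchberger's
  criterion makes \<open>\<G>\<^sup>d\<^sup>e\<^sup>h\<close> a Groebner basis of \<open>N\<^sup>d\<^sup>e\<^sup>h\<close>.

  For saturating remainders the same expression exists before dehomogenization: a homogeneous
  remainder is a power product in the \<open>y\<^sub>i\<close> times its saturation
  (\<open>homogeneous_eq_y_saturation\<close>), so the saturation, once it is added to \<open>\<G>\<close>, accounts for the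
  remainder (\<open>sat_S_pair_lifts\<close>).  The criterion, now for \<open>\<sigma>\<close>-bar, applies to \<open>\<G>\<close> and the graded
  module that it generates; this module has the same dehomogenization, hence the same
  saturation, as \<open>N\<close>.

  The ordering \<open>\<sigma>\<close> may have infinite descending chains, also inside a fixed degree.  The usual proof of the
  criterion, which lowers the leading terms in a representation of \<open>f\<close> until they cannot be
  lowered any more, then need not come to an end.  Mora's method for local orderings replaces it:
  \<open>f\<close> may first be multiplied by a polynomial \<open>u = 1 + (smaller terms)\<close>, which does not change its
  leading term, and among the representations of all such multiples \<open>u f\<close> there is one whose
  Schreyer leading term is not divisible by the leading term of any syzygy (\<open>Mora_descent\<close>).  In that
  representation the top terms cannot cancel (\<open>Buchberger_criterion\<close>).

  Termination is Dickson's lemma: a vector enters \<open>\<G>\<close> only if its leading term is not divisible by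
  an earlier one, and between two additions the finitely many generators and pairs are used up
  (\<open>buchberger_terminates\<close>).  If \<open>\<sigma>\<close> is well-founded, so is \<open>\<sigma>\<close>-bar on each degree, and reducing leading terms
  ends in a remainder (\<open>remainder_exists\<close>).
\<close>

section \<open>Dickson's lemma\<close>

lemma mono_subsequence_nat:
  fixes f :: "nat \<Rightarrow> nat"
  shows "\<exists>\<phi>::nat \<Rightarrow> nat. strict_mono \<phi> \<and> mono (\<lambda>k. f (\<phi> k))"
proof -
  obtain \<phi> :: "nat \<Rightarrow> nat" where \<phi>: "strict_mono \<phi>" "monoseq (\<lambda>k. real (f (\<phi> k)))"
    using seq_monosub[of "\<lambda>k. real (f k)"] by auto
  show ?thesis
  proof (cases "incseq (\<lambda>k. real (f (\<phi> k)))")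
    case True
    then have "mono (\<lambda>k. f (\<phi> k))" by (simp add: mono_def)
    then show ?thesis using \<phi>(1) by (intro exI[of _ \<phi>] conjI)
  next
    case False
    then have dec: "f (\<phi> j) \<le> f (\<phi> i)" if "i \<le> j" for i j
      using \<phi>(2) that by (auto simp: monoseq_iff decseq_def)
    (* A decreasing sequence is constant from the place on where it attains its minimum. *)
    define m where "m = (LEAST x. x \<in> range (\<lambda>k. f (\<phi> k)))"
    have "m \<in> range (\<lambda>k. f (\<phi> k))" unfolding m_def by (rule LeastI[of _ "f (\<phi> 0)"]) simp
    then obtain K where K: "m = f (\<phi> K)" by blast
    have least: "m \<le> f (\<phi> k)" for k unfolding m_def by (rule Least_le) simp
    have "f (\<phi> (K + k)) = m" for k
      using dec[of K "K + k"] least[of "K + k"] K by simp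
    then have "mono (\<lambda>k. f (\<phi> (K + k)))" by (simp add: mono_def)
    moreover have "strict_mono (\<lambda>k. \<phi> (K + k))"
      using \<phi>(1) by (simp add: strict_mono_def)
    ultimately show ?thesis by (intro exI[of _ "\<lambda>k. \<phi> (K + k)"]) simp
  qed
qed

lemma mono_subsequence_coords:
  fixes f :: "'c \<Rightarrow> nat \<Rightarrow> nat"
  assumes "finite C"
  shows "\<exists>\<phi>::nat \<Rightarrow> nat. strict_mono \<phi> \<and> (\<forall>c\<in>C. mono (\<lambda>k. f c (\<phi> k)))"
  using assms
proof (induction C rule: finite_induct)
  case empty
  then show ?case by (intro exI[of _ "\<lambda>k. k"]) (simp add: strict_mono_def)
next
  case (insert c C)
  then obtain \<phi> :: "nat \<Rightarrow> nat" where \<phi>: "strict_mono \<phi>" "\<forall>c\<in>C. mono (\<lambda>k. f c (\<phi> k))" by blast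
  obtain \<psi> :: "nat \<Rightarrow> nat" where \<psi>: "strict_mono \<psi>" "mono (\<lambda>k. f c (\<phi> (\<psi> k)))"
    using mono_subsequence_nat[of "\<lambda>k. f c (\<phi> k)"] by auto
  have "strict_mono (\<lambda>k. \<phi> (\<psi> k))" using \<phi>(1) \<psi>(1) by (simp add: strict_mono_def)
  moreover have "\<forall>d\<in>insert c C. mono (\<lambda>k. f d (\<phi> (\<psi> k)))"
    using \<phi>(2) \<psi> strict_mono_less_eq[OF \<psi>(1)] unfolding mono_def by blast
  ultimately show ?case by (intro exI[of _ "\<lambda>k. \<phi> (\<psi> k)"]) simp
qed

lemma term_dvdI:
  assumes "snd u = snd w" "\<And>x. Poly_Mapping.lookup (fst u) x \<le> Poly_Mapping.lookup (fst w) x"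
  shows "term_dvd u w"
proof -
  have "w = term_mult (fst w - fst u) u"
    unfolding term_mult_def using assms
    by (auto intro!: prod_eqI poly_mapping_eqI simp: lookup_add lookup_minus)
  then show ?thesis unfolding term_dvd_def by blast
qed

lemma term_dvd_iff:
  "term_dvd u w \<longleftrightarrow> snd u = snd w \<and>
     (\<forall>x. Poly_Mapping.lookup (fst u) x \<le> Poly_Mapping.lookup (fst w) x)"
  using term_dvdI[of u w] by (auto simp: term_dvd_def term_mult_def lookup_add)

lemma term_dvd_trans: "term_dvd u v \<Longrightarrow> term_dvd v w \<Longrightarrow> term_dvd u w"
  unfolding term_dvd_iff by (metis order_trans)

text \<open>
  The additional weights \<open>e\<close> act like one more indeterminate.  Finitely many components are
  handled by treating the indicator of each component as a further exponent: in a subsequence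
  along which all indicators are monotone, the component of the first term never changes.
\<close>

lemma Dickson:
  fixes s :: "nat \<Rightarrow> ('v::finite, 'i) trm" and e :: "nat \<Rightarrow> nat"
  assumes "finite I" "\<And>k. snd (s k) \<in> I"
  shows "\<exists>i j. i < j \<and> term_dvd (s i) (s j) \<and> e i \<le> e j"
proof -
  let ?f = "\<lambda>c k. case c of None \<Rightarrow> e k
     | Some (Inl x) \<Rightarrow> Poly_Mapping.lookup (fst (s k)) x
     | Some (Inr i) \<Rightarrow> if snd (s k) = i then 1 else (0::nat)"
  let ?C = "insert None (Some ` (range Inl \<union> Inr ` I)) :: ('v + 'i) option set"
  have "finite ?C"
    using assms(1) by (intro finite.insertI finite_imageI finite_UnI finite_class.finite_UNIV)
  from mono_subsequence_coords[OF this, of ?f]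
  obtain \<phi> :: "nat \<Rightarrow> nat" where \<phi>: "strict_mono \<phi>"
    "\<forall>c\<in>?C. mono (\<lambda>k. ?f c (\<phi> k))" by blast
  have le: "?f c (\<phi> 0) \<le> ?f c (\<phi> 1)"
    if "c \<in> ?C" for c
    using \<phi>(2) that unfolding mono_def by blast
  have "e (\<phi> 0) \<le> e (\<phi> 1)" using le[of None] by simp
  moreover have "Poly_Mapping.lookup (fst (s (\<phi> 0))) x \<le> Poly_Mapping.lookup (fst (s (\<phi> 1))) x" for x
    using le[of "Some (Inl x)"] by simp
  moreover have "snd (s (\<phi> 0)) = snd (s (\<phi> 1))"
    using le[of "Some (Inr (snd (s (\<phi> 0))))"] assms(2) by (auto split: if_splits)
  moreover have "\<phi> 0 < \<phi> 1" using \<phi>(1) by (simp add: strict_mono_def)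
  ultimately show ?thesis using term_dvdI by blast
qed

text \<open>
  A set all of whose finite subsets fail to be such a basis would yield, by repeated choice, a
  sequence that contradicts Dickson's lemma.
\<close>

lemma finite_divisor_basis:
  fixes lead :: "'y \<Rightarrow> ('v::finite, 'i) trm" and e :: "'y \<Rightarrow> nat"
  assumes "finite I" "\<And>y. y \<in> Y \<Longrightarrow> snd (lead y) \<in> I"
  shows "\<exists>T\<subseteq>Y. finite T \<and> (\<forall>y\<in>Y. \<exists>g\<in>T. term_dvd (lead g) (lead y) \<and> e g \<le> e y)"
proof (rule ccontr)
  assume neg: "\<not> ?thesis"
  have "\<exists>f :: nat \<Rightarrow> 'y. \<forall>n. f n \<in> Y \<and> (\<forall>m<n. \<not> (term_dvd (lead (f m)) (lead (f n)) \<and> e (f m) \<le> e (f n)))"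
  proof (rule dependent_wellorder_choice)
    fix f :: "nat \<Rightarrow> 'y" and n
    assume prev: "\<And>k. k < n \<Longrightarrow> f k \<in> Y \<and>
      (\<forall>m<k. \<not> (term_dvd (lead (f m)) (lead (f k)) \<and> e (f m) \<le> e (f k)))"
    then have "f ` {..<n} \<subseteq> Y" "finite (f ` {..<n})" by auto
    then have "\<not> (\<forall>y\<in>Y. \<exists>g\<in>f ` {..<n}. term_dvd (lead g) (lead y) \<and> e g \<le> e y)"
      using neg by (meson)
    then obtain y where "y \<in> Y" "\<forall>g\<in>f ` {..<n}. \<not> (term_dvd (lead g) (lead y) \<and> e g \<le> e y)"
      by blast
    then show "\<exists>y. y \<in> Y \<and> (\<forall>m<n. \<not> (term_dvd (lead (f m)) (lead y) \<and> e (f m) \<le> e y))" by auto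
  qed auto
  then obtain f :: "nat \<Rightarrow> 'y" where "\<forall>n. f n \<in> Y \<and>
      (\<forall>m<n. \<not> (term_dvd (lead (f m)) (lead (f n)) \<and> e (f m) \<le> e (f n)))"
    by (elim exE)
  then have f: "\<And>n. f n \<in> Y"
    "\<And>m n. m < n \<Longrightarrow> \<not> (term_dvd (lead (f m)) (lead (f n)) \<and> e (f m) \<le> e (f n))"
    by simp_all
  have "snd (lead (f k)) \<in> I" for k using assms(2) f(1) .
  then show False
    using Dickson[OF assms(1), of "\<lambda>n. lead (f n)" "\<lambda>n. e (f n)"] f(2) by meson
qed


section \<open>Coefficients, supports and leading terms\<close>

lemma fmod_eqI: "(\<And>u. coeff v u = coeff w u) \<Longrightarrow> v = w"
  by (force simp: coeff_def vec_eq_iff intro!: poly_mapping_eqI)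

lemma coeff_zero [simp]: "coeff 0 u = 0"
  by (simp add: coeff_def)

lemma coeff_add [simp]: "coeff (v + w) u = coeff v u + coeff w u"
  by (simp add: coeff_def lookup_add)

lemma coeff_diff [simp]:
  fixes v :: "('k::ab_group_add, 'v, 'r::finite) fmod"
  shows "coeff (v - w) u = coeff v u - coeff w u"
  by (simp add: coeff_def lookup_minus)

lemma coeff_sum: "coeff (sum f A) u = (\<Sum>a\<in>A. coeff (f a) u)"
  by (induction A rule: infinite_finite_induct) auto

lemma in_supp_iff: "u \<in> supp v \<longleftrightarrow> coeff v u \<noteq> 0"
  by (simp add: supp_def)

lemma supp_zero [simp]: "supp 0 = {}"
  by (simp add: supp_def)

lemma finite_supp [simp]: "finite (supp v)"
proof -
  have "supp v = (\<Union>i. (\<lambda>t. (t, i)) ` Poly_Mapping.keys (v $ i))"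
    by (force simp: supp_def coeff_def in_keys_iff)
  then show ?thesis by simp
qed

lemma supp_eq_empty_iff [simp]: "supp v = {} \<longleftrightarrow> v = 0"
  by (auto simp: supp_def intro!: fmod_eqI)

lemma supp_add_subset: "supp (v + w) \<subseteq> supp v \<union> supp w"
  by (auto simp: supp_def)

lemma supp_diff_subset:
  fixes v :: "('k::ab_group_add, 'v, 'r::finite) fmod"
  shows "supp (v - w) \<subseteq> supp v \<union> supp w"
  by (auto simp: supp_def)

lemma supp_sum_subset: "supp (sum f A) \<subseteq> (\<Union>a\<in>A. supp (f a))"
  by (induction A rule: infinite_finite_induct) (auto dest: subsetD[OF supp_add_subset])

lemma term_mult_assoc: "term_mult s (term_mult t u) = term_mult (s + t) u"
  by (simp add: term_mult_def add.assoc)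

lemma term_mult_zero [simp]: "term_mult 0 u = u"
  by (simp add: term_mult_def)

lemma term_mult_cancel [simp]: "term_mult s u = term_mult s w \<longleftrightarrow> u = w"
  by (cases u; cases w) (simp add: term_mult_def)

lemma snd_term_mult [simp]: "snd (term_mult s u) = snd u"
  by (simp add: term_mult_def)

lemma fst_term_mult [simp]: "fst (term_mult s u) = s + fst u"
  by (simp add: term_mult_def)

text \<open>
  Reduces statements about multiplication by polynomials to multiplication by monomials.
\<close>

lemma monomial_decomposition:
  "p = (\<Sum>t\<in>Poly_Mapping.keys p. Poly_Mapping.single t (Poly_Mapping.lookup p t))"
  by (rule poly_mapping_eqI) (auto simp: lookup_sum lookup_single when_def in_keys_iff)

lemma lookup_monomial_mult:
  fixes p :: "'v pp \<Rightarrow>\<^sub>0 'k::comm_ring_1"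
  shows "Poly_Mapping.lookup (Poly_Mapping.single m c * p) (m + t) = c * Poly_Mapping.lookup p t"
proof -
  have "Poly_Mapping.single m c * p =
      (\<Sum>s\<in>Poly_Mapping.keys p. Poly_Mapping.single (m + s) (c * Poly_Mapping.lookup p s))"
    by (subst (1) monomial_decomposition[of p]) (simp add: sum_distrib_left mult_single)
  then show ?thesis by (auto simp: lookup_sum lookup_single when_def in_keys_iff)
qed

lemma coeff_monomial_mult [simp]:
  fixes v :: "('k::comm_ring_1, 'v, 'r::finite) fmod"
  shows "coeff (Poly_Mapping.single m c *s v) (term_mult m u) = c * coeff v u"
  by (simp add: coeff_def term_mult_def lookup_monomial_mult)

lemma supp_multE:
  fixes v :: "('k::comm_ring_1, 'v, 'r::finite) fmod"
  assumes "u \<in> supp (p *s v)"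
  obtains t w where "u = term_mult t w" "t \<in> Poly_Mapping.keys p" "w \<in> supp v"
proof -
  have "fst u \<in> Poly_Mapping.keys (p * v $ snd u)"
    using assms by (simp add: supp_def coeff_def in_keys_iff)
  then obtain a b where ab: "fst u = a + b" "a \<in> Poly_Mapping.keys p"
      "b \<in> Poly_Mapping.keys (v $ snd u)"
    using keys_mult by blast
  then have "u = term_mult a (b, snd u)" "(b, snd u) \<in> supp v"
    by (auto simp: term_mult_def in_supp_iff coeff_def in_keys_iff prod_eq_iff)
  then show thesis using ab(2) that by blast
qed

lemma keys_monomial_multE:
  fixes p :: "'v pp \<Rightarrow>\<^sub>0 'k::comm_ring_1"
  assumes "t \<in> Poly_Mapping.keys (Poly_Mapping.single m c * p)"
  obtains b where "t = m + b" "b \<in> Poly_Mapping.keys p"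
proof -
  obtain a b where "t = a + b" "a \<in> Poly_Mapping.keys (Poly_Mapping.single m c)" "b \<in> Poly_Mapping.keys p"
    using assms keys_mult by blast
  then show thesis using that by (auto split: if_splits)
qed

lemma supp_monomial_mult:
  fixes v :: "('k::field, 'v, 'r::finite) fmod"
  assumes "c \<noteq> 0"
  shows "supp (Poly_Mapping.single m c *s v) = term_mult m ` supp v"
proof
  show "supp (Poly_Mapping.single m c *s v) \<subseteq> term_mult m ` supp v"
    by (auto elim!: supp_multE split: if_splits)
  show "term_mult m ` supp v \<subseteq> supp (Poly_Mapping.single m c *s v)"
    using assms by (auto simp: in_supp_iff)
qed

lemma finite_total_order_max:
  assumes "finite A" "A \<noteq> {}" "transp \<rho>" "totalp \<rho>"
  shows "\<exists>u\<in>A. \<forall>w\<in>A. w \<noteq> u \<longrightarrow> \<rho> w u"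
  using assms(1,2)
proof (induction A rule: finite_ne_induct)
  case (insert x A)
  then obtain u where u: "u \<in> A" "\<forall>w\<in>A. w \<noteq> u \<longrightarrow> \<rho> w u" by blast
  have "x \<noteq> u" using u insert by blast
  then consider "\<rho> x u" | "\<rho> u x" using assms(4) by (auto simp: totalp_on_def)
  then show ?case
  proof cases
    case 1
    then show ?thesis using u by (intro bexI[of _ u]) auto
  next
    case 2
    then have "\<rho> w x" if "w \<in> A" for w
      using u that assms(3) by (cases "w = u") (auto dest: transpD)
    then show ?thesis by (intro bexI[of _ x]) auto
  qed
qed simp

lemma module_orderingD:
  assumes "module_ordering \<sigma>"
  shows "transp \<sigma>" "totalp \<sigma>" "\<not> \<sigma> u u"
    "\<sigma> u w \<Longrightarrow> \<sigma> (term_mult s u) (term_mult s w)"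
    "\<sigma> u v \<Longrightarrow> \<sigma> v w \<Longrightarrow> \<sigma> u w"
    "\<sigma> u v \<or> u = v \<or> \<sigma> v u"
proof -
  show tr: "transp \<sigma>" and to: "totalp \<sigma>" using assms by (simp_all only: module_ordering_def)
  show "\<not> \<sigma> u u" using assms by (simp only: module_ordering_def irreflp_def) simp
  show "\<sigma> u w \<Longrightarrow> \<sigma> (term_mult s u) (term_mult s w)"
    using assms by (simp only: module_ordering_def)
  show "\<sigma> u v \<Longrightarrow> \<sigma> v w \<Longrightarrow> \<sigma> u w" using tr by (rule transpD)
  show "\<sigma> u v \<or> u = v \<or> \<sigma> v u" using totalpD[OF to, of u v] by blast
qed

lemma LT_eqI:
  assumes "module_ordering \<sigma>" "u \<in> supp v" "\<And>w. w \<in> supp v \<Longrightarrow> w \<noteq> u \<Longrightarrow> \<sigma> w u"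
  shows "LT \<sigma> v = u"
  unfolding LT_def
proof (rule the_equality)
  fix u' assume "u' \<in> supp v \<and> (\<forall>w\<in>supp v. w \<noteq> u' \<longrightarrow> \<sigma> w u')"
  then show "u' = u" using assms module_orderingD(3,5)[OF assms(1)] by metis
qed (use assms in auto)

lemma
  assumes "module_ordering \<sigma>" "v \<noteq> 0"
  shows LT_in_supp: "LT \<sigma> v \<in> supp v"
    and LT_greatest: "w \<in> supp v \<Longrightarrow> w \<noteq> LT \<sigma> v \<Longrightarrow> \<sigma> w (LT \<sigma> v)"
proof -
  obtain u where u: "u \<in> supp v" "\<forall>w\<in>supp v. w \<noteq> u \<longrightarrow> \<sigma> w u"
    using finite_total_order_max[of "supp v" \<sigma>] assms module_orderingD(1,2)[OF assms(1)] by auto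
  then have "LT \<sigma> v = u" using LT_eqI[OF assms(1)] by blast
  with u show "LT \<sigma> v \<in> supp v" "w \<in> supp v \<Longrightarrow> w \<noteq> LT \<sigma> v \<Longrightarrow> \<sigma> w (LT \<sigma> v)" by auto
qed

lemma LC_nonzero:
  assumes "module_ordering \<sigma>" "v \<noteq> 0"
  shows "LC \<sigma> v \<noteq> 0"
  using LT_in_supp[OF assms] by (simp add: LC_def in_supp_iff)

lemma LT_monomial_mult:
  fixes v :: "('k::field, 'v, 'r::finite) fmod"
  assumes "module_ordering \<sigma>" "v \<noteq> 0" "c \<noteq> 0"
  shows "LT \<sigma> (Poly_Mapping.single m c *s v) = term_mult m (LT \<sigma> v)"
proof (rule LT_eqI[OF assms(1)])
  show "term_mult m (LT \<sigma> v) \<in> supp (Poly_Mapping.single m c *s v)"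
    unfolding supp_monomial_mult[OF assms(3)] using LT_in_supp[OF assms(1,2)] by (rule imageI)
next
  fix w assume w: "w \<in> supp (Poly_Mapping.single m c *s v)" "w \<noteq> term_mult m (LT \<sigma> v)"
  then obtain w' where w': "w = term_mult m w'" "w' \<in> supp v"
    unfolding supp_monomial_mult[OF assms(3)] by (elim imageE)
  with w(2) have "w' \<noteq> LT \<sigma> v" by auto
  then show "\<sigma> w (term_mult m (LT \<sigma> v))"
    unfolding w'(1) by (intro module_orderingD(4)[OF assms(1)] LT_greatest[OF assms(1,2)] w'(2))
qed


section \<open>Mora's descent\<close>

lemma finite_bounded_pps:
  "finite {m :: 'v::finite pp. (\<Sum>x\<in>UNIV. Poly_Mapping.lookup m x) \<le> D}"
proof (rule finite_imageD)
  have "Poly_Mapping.lookup ` {m :: 'v pp. (\<Sum>x\<in>UNIV. Poly_Mapping.lookup m x) \<le> D}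
      \<subseteq> PiE UNIV (\<lambda>_. {..D})"
  proof clarify
    fix m :: "'v pp" assume m: "(\<Sum>x\<in>UNIV. Poly_Mapping.lookup m x) \<le> D"
    have "Poly_Mapping.lookup m x \<le> (\<Sum>x\<in>UNIV. Poly_Mapping.lookup m x)" for x
      by (rule member_le_sum) auto
    then have "Poly_Mapping.lookup m x \<le> D" for x using m order_trans by blast
    then show "Poly_Mapping.lookup m \<in> PiE UNIV (\<lambda>_. {..D})" by (simp add: PiE_def Pi_def)
  qed
  then show "finite (Poly_Mapping.lookup ` {m :: 'v pp. (\<Sum>x\<in>UNIV. Poly_Mapping.lookup m x) \<le> D})"
    by (rule finite_subset) (intro finite_PiE, auto)
  show "inj_on Poly_Mapping.lookup {m :: 'v pp. (\<Sum>x\<in>UNIV. Poly_Mapping.lookup m x) \<le> D}"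
    by (simp add: inj_on_def lookup_inject)
qed

text \<open>
  The elements of \<open>X\<close> and \<open>S\<close> stand for vectors, \<open>A y\<close> for the set of terms of \<open>y\<close>, and \<open>red\<close> for
  the cancellation of the leading term of \<open>r\<close> by a multiple of \<open>g\<close>.  Cancelling with elements
  of \<open>S\<close> alone need not stop, because the terms may descend forever.  Mora's idea is to cancel
  also with elements of \<open>X\<close> itself, provided that they have a larger leading term, and to
  prefer a \<open>g\<close> whose ecart (degree minus degree of the leading term) does not exceed that of \<open>r\<close>.
  Such a cancellation does not raise the degree, so that only finitely many leading terms are within
  reach.  By Dickson's lemma, applied to leading terms together with ecarts, a finite set \<open>T\<close>
  provides a suitable \<open>g\<close> for every \<open>r\<close>.
\<close>

lemma Mora_descent:
  fixes A :: "'y \<Rightarrow> ('v::finite, 'i) trm set" and lead :: "'y \<Rightarrow> ('v, 'i) trm"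
  assumes \<rho>: "transp \<rho>" "totalp \<rho>" "\<And>u. \<not> \<rho> u u"
      "\<And>s u w. \<rho> u w \<Longrightarrow> \<rho> (term_mult s u) (term_mult s w)"
    and I: "finite I"
    and A: "\<And>y. y \<in> X \<union> S \<Longrightarrow> finite (A y)" "\<And>y. y \<in> X \<union> S \<Longrightarrow> snd ` A y \<subseteq> I"
    and lead: "\<And>y. y \<in> X \<union> S \<Longrightarrow> lead y \<in> A y"
      "\<And>y w. y \<in> X \<union> S \<Longrightarrow> w \<in> A y \<Longrightarrow> w \<noteq> lead y \<Longrightarrow> \<rho> w (lead y)"
    and red: "\<And>r g m. r \<in> X \<Longrightarrow> g \<in> X \<union> S \<Longrightarrow> lead r = term_mult m (lead g) \<Longrightarrow>
      g \<in> S \<or> \<rho> (lead r) (lead g) \<Longrightarrow> \<exists>r'\<in>X. A r' \<subseteq> (A r \<union> term_mult m ` A g) - {lead r}"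
    and X: "X \<noteq> {}"
  shows "\<exists>r\<in>X. \<forall>s\<in>S. \<not> term_dvd (lead s) (lead r)"
proof (rule ccontr)
  assume "\<not> ?thesis"
  then have dvd: "\<exists>s\<in>S. term_dvd (lead s) (lead r)" if "r \<in> X" for r using that by blast
  define wt :: "('v, 'i) trm \<Rightarrow> nat" where "wt u = (\<Sum>x\<in>UNIV. Poly_Mapping.lookup (fst u) x)" for u
  have wt_mult: "wt (term_mult m u) = (\<Sum>x\<in>UNIV. Poly_Mapping.lookup m x) + wt u" for m u
    by (simp add: wt_def lookup_add sum.distrib)
  define deg where "deg y = Max (wt ` A y)" for y
  define ecart where "ecart y = deg y - wt (lead y)" for y
  have wt_le: "wt w \<le> deg y" if "y \<in> X \<union> S" "w \<in> A y" for y w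
    unfolding deg_def using that A(1) by (intro Max_ge) auto
  have red': "\<exists>r'\<in>X. A r' \<subseteq> A r \<union> term_mult m ` A g \<and> \<rho> (lead r') (lead r)"
    if h: "r \<in> X" "g \<in> X \<union> S" "lead r = term_mult m (lead g)" "g \<in> S \<or> \<rho> (lead r) (lead g)" for r g m
  proof -
    obtain r' where r': "r' \<in> X" "A r' \<subseteq> (A r \<union> term_mult m ` A g) - {lead r}"
      using red[OF h] by (elim bexE)
    then have mem: "lead r' \<in> (A r \<union> term_mult m ` A g) - {lead r}" using lead(1)[of r'] by blast
    have "\<rho> (lead r') (lead r)"
    proof (cases "lead r' \<in> A r")
      case True
      then show ?thesis using lead(2)[of r] h(1) mem by blast
    next
      case False
      then obtain w where w: "lead r' = term_mult m w" "w \<in> A g" using mem by blast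
      then have "w \<noteq> lead g" using mem h(3) by auto
      then show ?thesis using \<rho>(4)[OF lead(2)[OF h(2) w(2)], of m] w(1) h(3) by simp
    qed
    then show ?thesis using r' by blast
  qed
  have "\<exists>T\<subseteq>X \<union> S. finite T \<and> (\<forall>y\<in>X \<union> S. \<exists>g\<in>T. term_dvd (lead g) (lead y) \<and> ecart g \<le> ecart y)"
    using A(2) lead(1) by (intro finite_divisor_basis[OF I]) blast
  then obtain T where T: "T \<subseteq> X \<union> S" "finite T"
      "\<And>y. y \<in> X \<union> S \<Longrightarrow> \<exists>g\<in>T. term_dvd (lead g) (lead y) \<and> ecart g \<le> ecart y"
    by (elim exE conjE) blast
  have min: "\<exists>u\<in>U. \<forall>w\<in>U. w \<noteq> u \<longrightarrow> \<rho> u w" if "finite U" "U \<noteq> {}" for U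
  proof -
    have "transp (\<lambda>x y. \<rho> y x)" "totalp (\<lambda>x y. \<rho> y x)"
      using \<rho>(1) totalpD[OF \<rho>(2)] by (intro transpI totalpI; blast dest: transpD)+
    then show ?thesis using finite_total_order_max[OF that] by blast
  qed
  have trans: "\<rho> u v \<Longrightarrow> \<rho> v w \<Longrightarrow> \<rho> u w" for u v w using \<rho>(1) by (rule transpD)
  (* Below all of T, every cancellation with an element of T is permitted. *)
  obtain r1 where r1: "r1 \<in> X" "\<forall>g\<in>T \<inter> X. \<rho> (lead r1) (lead g)"
  proof (cases "T \<inter> X = {}")
    case True
    then show ?thesis using that X by blast
  next
    case False
    then obtain r0 where r0: "r0 \<in> T \<inter> X"
        "\<forall>g\<in>T \<inter> X. lead g \<noteq> lead r0 \<longrightarrow> \<rho> (lead r0) (lead g)"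
      using min[of "lead ` (T \<inter> X)"] T(2) by blast
    obtain s m where s: "s \<in> S" "lead r0 = term_mult m (lead s)"
      using dvd[of r0] r0(1) unfolding term_dvd_def by blast
    obtain r' where r': "r' \<in> X" "\<rho> (lead r') (lead r0)"
      using red'[of r0 s m] r0(1) s by blast
    then have "\<rho> (lead r') (lead g)" if "g \<in> T \<inter> X" for g
      using r0(2) that trans by metis
    then show ?thesis using that r'(1) by blast
  qed
  (* The smallest leading term in the bounded degree range; one more cancellation lowers it. *)
  define Z where "Z = {r \<in> X. deg r \<le> deg r1 \<and> (\<forall>g\<in>T \<inter> X. \<rho> (lead r) (lead g))}"
  have "lead ` Z \<subseteq> {m. (\<Sum>x\<in>UNIV. Poly_Mapping.lookup m x) \<le> deg r1} \<times> I"
  proof clarify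
    fix r t i assume r: "r \<in> Z" "(t, i) = lead r"
    then have rX: "r \<in> X \<union> S" "deg r \<le> deg r1" by (auto simp: Z_def)
    then have "wt (t, i) \<le> deg r1"
      using wt_le[OF rX(1) lead(1)[OF rX(1)]] r(2) by simp
    moreover have "i \<in> I"
      using A(2)[OF rX(1)] imageI[OF lead(1)[OF rX(1)], of snd] r(2)[symmetric] by auto
    ultimately show "t \<in> {m. (\<Sum>x\<in>UNIV. Poly_Mapping.lookup m x) \<le> deg r1} \<and> i \<in> I"
      by (simp add: wt_def)
  qed
  then have "finite (lead ` Z)"
    using finite_subset finite_cartesian_product[OF finite_bounded_pps I] by blast
  moreover have "r1 \<in> Z" using r1 by (simp add: Z_def)
  ultimately obtain r2 where r2: "r2 \<in> Z" "\<And>r. r \<in> Z \<Longrightarrow> lead r \<noteq> lead r2 \<Longrightarrow> \<rho> (lead r2) (lead r)"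
    using min[of "lead ` Z"] by blast
  then have r2X: "r2 \<in> X" "deg r2 \<le> deg r1" "\<forall>g\<in>T \<inter> X. \<rho> (lead r2) (lead g)" by (auto simp: Z_def)
  obtain g m where g: "g \<in> T" "lead r2 = term_mult m (lead g)" "ecart g \<le> ecart r2"
    using T(3)[of r2] r2X(1) unfolding term_dvd_def by blast
  have gY: "g \<in> X \<union> S" using g(1) T(1) by blast
  have "g \<in> S \<or> \<rho> (lead r2) (lead g)" using gY g(1) r2X(3) by blast
  from red'[OF r2X(1) gY g(2) this]
  obtain r' where r': "r' \<in> X" "A r' \<subseteq> A r2 \<union> term_mult m ` A g" "\<rho> (lead r') (lead r2)"
    by blast
  have wt2: "wt (term_mult m w) \<le> deg r2" if "w \<in> A g" for w
  proof -
    have "wt w \<le> wt (lead g) + ecart g"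
      using wt_le[OF gY that] by (simp add: ecart_def)
    then have "wt (term_mult m w) \<le> wt (lead r2) + ecart g" by (simp add: g(2) wt_mult)
    also have "\<dots> \<le> wt (lead r2) + ecart r2" using g(3) by simp
    also have "\<dots> = deg r2" using wt_le[of r2 "lead r2"] lead(1)[of r2] r2X(1) by (simp add: ecart_def)
    finally show ?thesis .
  qed
  have "wt w \<le> deg r2" if "w \<in> A r'" for w
    using that r'(2) wt2 wt_le[of r2 w] r2X(1) by blast
  then have "wt w \<le> deg r1" if "w \<in> A r'" for w using that r2X(2) order_trans by blast
  then have "deg r' \<le> deg r1"
    unfolding deg_def[of r'] using A(1)[of r'] lead(1)[of r'] r'(1) by (intro Max.boundedI) auto
  then have "r' \<in> Z" using r' r2X(3) trans unfolding Z_def by blast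
  then show False using r2(2)[of r'] r'(3) \<rho>(3) trans by metis
qed

section \<open>Buchberger's criterion for arbitrary module orderings\<close>

text \<open>
  The right-hand sides of the lifting condition in Buchberger's criterion: an S-vector has to be a
  sum of multiples of elements of \<open>G\<close> with leading terms smaller than \<open>B\<close>, the least common
  multiple.  An inductive set makes it easy to record one division step after the other while
  \<open>G\<close> grows.
\<close>

inductive_set lower_sums :: "(('v, 'r) trm \<Rightarrow> ('v, 'r) trm \<Rightarrow> bool)
    \<Rightarrow> ('k::field, 'v, 'r::finite) fmod set \<Rightarrow> ('v, 'r) trm \<Rightarrow> ('k, 'v, 'r) fmod set"
  for \<sigma> G B where
  zero: "0 \<in> lower_sums \<sigma> G B"
| add: "Q \<in> lower_sums \<sigma> G B \<Longrightarrow> V \<in> G \<Longrightarrow> \<sigma> (term_mult t (LT \<sigma> V)) B \<Longrightarrow>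
    Q + Poly_Mapping.single t c *s V \<in> lower_sums \<sigma> G B"

lemma lower_sums_mono:
  assumes "G \<subseteq> G'"
  shows "Q \<in> lower_sums \<sigma> G B \<Longrightarrow> Q \<in> lower_sums \<sigma> G' B"
  by (induction rule: lower_sums.induct) (use assms in \<open>auto intro: lower_sums.intros\<close>)

text \<open>
  A representation of a vector by \<open>gs\<close> is a family \<open>r\<close> of coefficient polynomials indexed by
  positions in \<open>gs\<close>; it is regarded as an element of a free module with terms \<open>(t, k)\<close>.
\<close>

definition rep_supp :: "(nat \<Rightarrow> ('v pp \<Rightarrow>\<^sub>0 'k::zero)) \<Rightarrow> ('v, nat) trm set" where
  "rep_supp r = {u. fst u \<in> Poly_Mapping.keys (r (snd u))}"

definition rep_eval :: "('k::comm_ring_1, 'v, 'r::finite) fmod list \<Rightarrow> (nat \<Rightarrow> ('v pp \<Rightarrow>\<^sub>0 'k))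
    \<Rightarrow> ('k, 'v, 'r) fmod" where
  "rep_eval gs r = (\<Sum>k<length gs. r k *s gs ! k)"

definition rep_term :: "(('v, 'r) trm \<Rightarrow> ('v, 'r) trm \<Rightarrow> bool) \<Rightarrow> ('k::field, 'v, 'r::finite) fmod list
    \<Rightarrow> ('v, nat) trm \<Rightarrow> ('v, 'r) trm" where
  "rep_term \<sigma> gs u = term_mult (fst u) (LT \<sigma> (gs ! snd u))"

text \<open>
  The Schreyer ordering.  Positions break the ties, so that in the syzygy which comes from the pair
  \<open>i < j\<close> the term at \<open>j\<close> is the leading one.
\<close>

definition schreyer :: "(('v, 'r) trm \<Rightarrow> ('v, 'r) trm \<Rightarrow> bool) \<Rightarrow> ('k::field, 'v, 'r::finite) fmod list
    \<Rightarrow> ('v, nat) trm \<Rightarrow> ('v, nat) trm \<Rightarrow> bool" where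
  "schreyer \<sigma> gs u w \<longleftrightarrow> \<sigma> (rep_term \<sigma> gs u) (rep_term \<sigma> gs w) \<or>
     rep_term \<sigma> gs u = rep_term \<sigma> gs w \<and> snd u < snd w"

lemma rep_term_mult: "rep_term \<sigma> gs (term_mult m u) = term_mult m (rep_term \<sigma> gs u)"
  by (simp add: rep_term_def term_mult_assoc)

lemma schreyer_ordering:
  fixes gs :: "('k::field, 'v, 'r::finite) fmod list"
  assumes mo: "module_ordering \<sigma>"
  shows "transp (schreyer \<sigma> gs)" "totalp (schreyer \<sigma> gs)" "\<not> schreyer \<sigma> gs u u"
    "schreyer \<sigma> gs u w \<Longrightarrow> schreyer \<sigma> gs (term_mult s u) (term_mult s w)"
proof -
  show "transp (schreyer \<sigma> gs)"
    unfolding schreyer_def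
    by (rule transpI) (elim disjE conjE; auto dest: module_orderingD(5)[OF mo])
  show "totalp (schreyer \<sigma> gs)"
  proof (rule totalpI)
    fix u w :: "('v, nat) trm" assume "u \<noteq> w"
    then have "snd u \<noteq> snd w \<or> fst u \<noteq> fst w" using prod_eqI by blast
    then have "snd u \<noteq> snd w \<or> snd u = snd w \<and> rep_term \<sigma> gs u \<noteq> rep_term \<sigma> gs w"
      by (cases "snd u = snd w") (auto simp: rep_term_def term_mult_def)
    then show "schreyer \<sigma> gs u w \<or> schreyer \<sigma> gs w u"
      unfolding schreyer_def
      using module_orderingD(6)[OF mo, of "rep_term \<sigma> gs u" "rep_term \<sigma> gs w"] by force
  qed
  show "\<not> schreyer \<sigma> gs u u" using module_orderingD(3)[OF mo] by (simp add: schreyer_def)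
  show "schreyer \<sigma> gs u w \<Longrightarrow> schreyer \<sigma> gs (term_mult s u) (term_mult s w)"
    using module_orderingD(4)[OF mo, of "rep_term \<sigma> gs u" "rep_term \<sigma> gs w" s]
    by (auto simp: schreyer_def rep_term_mult)
qed

lemma finite_rep_supp:
  assumes "\<forall>k\<ge>l. r k = 0"
  shows "finite (rep_supp r)" "snd ` rep_supp r \<subseteq> {..<l}"
proof -
  show sub: "snd ` rep_supp r \<subseteq> {..<l}"
    using assms by (force simp: rep_supp_def not_le[symmetric])
  have "rep_supp r \<subseteq> (\<Union>k<l. (\<lambda>t. (t, k)) ` Poly_Mapping.keys (r k))"
  proof
    fix u assume u: "u \<in> rep_supp r"
    then have "snd u < l" using sub by blast
    then show "u \<in> (\<Union>k<l. (\<lambda>t. (t, k)) ` Poly_Mapping.keys (r k))"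
      using u by (cases u) (auto simp: rep_supp_def)
  qed
  then show "finite (rep_supp r)" by (rule finite_subset) auto
qed

lemma rep_eval_add: "rep_eval gs (\<lambda>k. r k + r' k) = rep_eval gs r + rep_eval gs r'"
  by (simp add: rep_eval_def sum.distrib fmod.scale_left_distrib)

lemma rep_eval_diff: "rep_eval gs (\<lambda>k. r k - r' k) = rep_eval gs r - rep_eval gs r'"
  by (simp add: rep_eval_def sum_subtractf fmod.scale_left_diff_distrib)

lemma rep_eval_scale: "rep_eval gs (\<lambda>k. p * r k) = p *s rep_eval gs r"
  by (simp add: rep_eval_def fmod.scale_sum_right)

lemma rep_eval_unit:
  "j < length gs \<Longrightarrow> rep_eval gs (\<lambda>k. p when k = j) = p *s gs ! j"
  by (simp add: rep_eval_def when_def if_distrib[of "\<lambda>x. x *s _"] sum.delta cong: if_cong)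

lemma span_rep:
  assumes "f \<in> fmod.span (set gs)"
  shows "\<exists>r. (\<forall>k\<ge>length gs. r k = 0) \<and> rep_eval gs r = f"
  using assms
proof (induction rule: fmod.span_induct_alt)
  case base
  show ?case by (rule exI[of _ "\<lambda>_. 0"]) (simp add: rep_eval_def)
next
  case (step p g f)
  then obtain r j where r: "\<forall>k\<ge>length gs. r k = 0" "rep_eval gs r = f" "j < length gs" "g = gs ! j"
    by (auto simp: in_set_conv_nth)
  then show ?case
    by (intro exI[of _ "\<lambda>k. (p when k = j) + r k"]) (simp add: rep_eval_add rep_eval_unit)
qed

lemma lower_sums_rep:
  assumes "Q \<in> lower_sums \<sigma> (set gs) B"
  shows "\<exists>r. (\<forall>k\<ge>length gs. r k = 0) \<and> rep_eval gs r = Q \<and> (\<forall>u\<in>rep_supp r. \<sigma> (rep_term \<sigma> gs u) B)"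
  using assms
proof (induction rule: lower_sums.induct)
  case zero
  show ?case by (rule exI[of _ "\<lambda>_. 0"]) (simp add: rep_eval_def rep_supp_def)
next
  case (add Q V t c)
  then obtain r j where r: "\<forall>k\<ge>length gs. r k = 0" "rep_eval gs r = Q" "j < length gs" "V = gs ! j"
      "\<forall>u\<in>rep_supp r. \<sigma> (rep_term \<sigma> gs u) B"
    by (auto simp: in_set_conv_nth)
  define r' where "r' = (\<lambda>k. r k + (Poly_Mapping.single t c when k = j))"
  have new: "u \<in> rep_supp r \<or> u = (t, j)" if "u \<in> rep_supp r'" for u
    using that keys_add[of "r (snd u)" "Poly_Mapping.single t c when snd u = j"]
    by (cases u) (auto simp: rep_supp_def r'_def when_def split: if_splits)
  have "\<sigma> (rep_term \<sigma> gs (t, j)) B" using r(4) add.hyps by (simp add: rep_term_def)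
  then have "\<forall>u\<in>rep_supp r'. \<sigma> (rep_term \<sigma> gs u) B"
    using r(5) new by blast
  moreover have "rep_eval gs r' = Q + Poly_Mapping.single t c *s V"
    using r(2-4) by (simp add: r'_def rep_eval_add rep_eval_unit)
  moreover have "\<forall>k\<ge>length gs. r' k = 0" using r(1,3) by (simp add: r'_def)
  ultimately show ?case by blast
qed

text \<open>
  The hypothesis \<open>red\<close> of \<open>Mora_descent\<close>, for representations.
\<close>

lemma rep_supp_diff_monomial_mult:
  fixes r g :: "nat \<Rightarrow> ('v pp \<Rightarrow>\<^sub>0 'k::field)" and m :: "'v pp"
  assumes "lg \<in> rep_supp g"
  defines "lr \<equiv> term_mult m lg"
  defines "c \<equiv> Poly_Mapping.lookup (r (snd lr)) (fst lr) / Poly_Mapping.lookup (g (snd lg)) (fst lg)"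
  shows "rep_supp (\<lambda>k. r k - Poly_Mapping.single m c * g k)
      \<subseteq> (rep_supp r \<union> term_mult m ` rep_supp g) - {lr}"
proof
  fix u assume u: "u \<in> rep_supp (\<lambda>k. r k - Poly_Mapping.single m c * g k)"
  then have ne: "Poly_Mapping.lookup (r (snd u)) (fst u)
      \<noteq> Poly_Mapping.lookup (Poly_Mapping.single m c * g (snd u)) (fst u)"
    by (simp add: rep_supp_def in_keys_iff lookup_minus)
  have "u \<noteq> lr"
  proof
    assume "u = lr"
    then show False
      using ne assms(1) by (auto simp: c_def lr_def lookup_monomial_mult rep_supp_def in_keys_iff)
  qed
  moreover have "u \<in> rep_supp r \<union> term_mult m ` rep_supp g"
  proof (cases "u \<in> rep_supp r")
    case False
    with ne have "fst u \<in> Poly_Mapping.keys (Poly_Mapping.single m c * g (snd u))"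
      by (simp add: rep_supp_def in_keys_iff)
    then obtain b where "fst u = m + b" "b \<in> Poly_Mapping.keys (g (snd u))"
      by (rule keys_monomial_multE)
    then have "u = term_mult m (b, snd u)" "(b, snd u) \<in> rep_supp g"
      by (auto simp: rep_supp_def prod_eq_iff)
    then show ?thesis by blast
  qed simp
  ultimately show "u \<in> (rep_supp r \<union> term_mult m ` rep_supp g) - {lr}" by blast
qed

text \<open>
  If a single term of the representation attains the largest product, nothing can cancel it.
\<close>

lemma LT_rep_eval:
  fixes gs :: "('k::field, 'v, 'r::finite) fmod list"
  assumes mo: "module_ordering \<sigma>" and nz: "0 \<notin> set gs"
    and r: "\<forall>k\<ge>length gs. r k = 0" and top: "u \<in> rep_supp r"
    and max: "\<And>w. w \<in> rep_supp r \<Longrightarrow> w \<noteq> u \<Longrightarrow> \<sigma> (rep_term \<sigma> gs w) (rep_term \<sigma> gs u)"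
  shows "LT \<sigma> (rep_eval gs r) = rep_term \<sigma> gs u"
proof -
  obtain t j where u: "u = (t, j)" by (cases u)
  let ?T = "rep_term \<sigma> gs u"
  define c where "c = Poly_Mapping.lookup (r j) t"
  have c: "c \<noteq> 0" and j: "j < length gs"
    using top r by (auto simp: u c_def rep_supp_def in_keys_iff not_le[symmetric])
  have gj: "gs ! k \<noteq> 0" if "k < length gs" for k using nz that nth_mem by metis
  define r' where "r' = (\<lambda>k. r k - (Poly_Mapping.single t c when k = j))"
  have r': "w \<in> rep_supp r" "w \<noteq> u" if "w \<in> rep_supp r'" for w
    using that by (cases w; auto simp: rep_supp_def r'_def when_def u c_def in_keys_iff lookup_minus lookup_single
      split: if_splits)+
  have below: "\<sigma> w ?T" if w: "w \<in> supp (rep_eval gs r')" for w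
  proof -
    obtain k where k: "k < length gs" "w \<in> supp (r' k *s gs ! k)"
    proof -
      have "w \<in> (\<Union>k<length gs. supp (r' k *s gs ! k))"
        using w unfolding rep_eval_def by (rule subsetD[OF supp_sum_subset])
      then show thesis using that by (elim UN_E) simp
    qed
    obtain s w' where w': "w = term_mult s w'" "s \<in> Poly_Mapping.keys (r' k)" "w' \<in> supp (gs ! k)"
      by (rule supp_multE[OF k(2)])
    have "(s, k) \<in> rep_supp r'" using w'(2) by (simp add: rep_supp_def)
    then have "\<sigma> (term_mult s (LT \<sigma> (gs ! k))) ?T"
      using max[of "(s, k)"] r'[of "(s, k)"] by (simp add: rep_term_def)
    moreover have "w = term_mult s (LT \<sigma> (gs ! k)) \<or> \<sigma> w (term_mult s (LT \<sigma> (gs ! k)))"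
      using LT_greatest[OF mo gj[OF k(1)] w'(3)] module_orderingD(4)[OF mo] w'(1) by blast
    ultimately show ?thesis using module_orderingD(5)[OF mo] by blast
  qed
  have split: "rep_eval gs r = Poly_Mapping.single t c *s gs ! j + rep_eval gs r'"
    unfolding rep_eval_unit[OF j, symmetric] rep_eval_add[symmetric] by (simp add: r'_def)
  have T: "?T = LT \<sigma> (Poly_Mapping.single t c *s gs ! j)"
    using LT_monomial_mult[OF mo gj[OF j] c] by (simp add: rep_term_def u)
  have nz': "Poly_Mapping.single t c *s gs ! j \<noteq> 0"
    using supp_monomial_mult[OF c, of t "gs ! j"] gj[OF j] by (metis image_is_empty supp_eq_empty_iff)
  show ?thesis
  proof (rule LT_eqI[OF mo])
    have "coeff (rep_eval gs r') ?T = 0"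
      using below[of ?T] module_orderingD(3)[OF mo] by (auto simp: in_supp_iff)
    then show "?T \<in> supp (rep_eval gs r)"
      using LT_in_supp[OF mo nz'] unfolding split T[symmetric] by (simp add: in_supp_iff)
  next
    fix w assume "w \<in> supp (rep_eval gs r)" "w \<noteq> ?T"
    then show "\<sigma> w ?T"
      using below LT_greatest[OF mo nz'] unfolding split T[symmetric]
      by (blast dest: subsetD[OF supp_add_subset])
  qed
qed


text \<open>
  The polynomials that become invertible in the localization belonging to \<open>\<tau>\<close>, normalized
  to constant coefficient \<open>1\<close>.
\<close>

definition local_unit :: "('v pp \<Rightarrow> 'v pp \<Rightarrow> bool) \<Rightarrow> ('v pp \<Rightarrow>\<^sub>0 'k::comm_ring_1) \<Rightarrow> bool" where
  "local_unit \<tau> u \<longleftrightarrow> Poly_Mapping.lookup u 0 = 1 \<and> (\<forall>t\<in>Poly_Mapping.keys u. t \<noteq> 0 \<longrightarrow> \<tau> t 0)"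

lemma local_unit_one: "local_unit \<tau> 1"
  by (simp add: local_unit_def)

text \<open>
  This is why \<open>Mora_descent\<close> permits a cancellation \<open>r - c m g\<close> with \<open>g\<close> in \<open>X\<close> only if the leading
  term of \<open>g\<close> is larger than that of \<open>r\<close>: then \<open>m\<close> is smaller than \<open>1\<close>.
\<close>

lemma local_unit_minus_smaller:
  assumes \<tau>: "monoid_ordering \<tau>" and u: "local_unit \<tau> u" and w: "local_unit \<tau> w" and m: "\<tau> m 0"
  shows "local_unit \<tau> (u - Poly_Mapping.single m c * w)"
proof -
  have "\<tau> t 0" if t: "t \<in> Poly_Mapping.keys (Poly_Mapping.single m c * w)" for t
  proof -
    obtain b where b: "t = m + b" "b \<in> Poly_Mapping.keys w"
      by (rule keys_monomial_multE[OF t])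
    show ?thesis
    proof (cases "b = 0")
      case False
      then have "\<tau> b 0" using b(2) w by (simp add: local_unit_def)
      then have "\<tau> (m + b) (m + 0)" using \<tau> unfolding monoid_ordering_def by blast
      then show ?thesis using m \<tau> b(1) unfolding monoid_ordering_def by (auto dest: transpD)
    qed (use b m in simp)
  qed
  moreover have "\<not> \<tau> 0 0" using \<tau> by (simp add: monoid_ordering_def irreflp_def)
  ultimately show ?thesis
    using u keys_diff[of u "Poly_Mapping.single m c * w"]
    unfolding local_unit_def by (auto simp: lookup_minus in_keys_iff)
qed

lemma LT_local_unit_mult:
  fixes f :: "('k::field, 'v, 'r::finite) fmod"
  assumes mo: "module_ordering \<sigma>" and \<tau>: "\<And>t1 t2 i. \<tau> t1 t2 \<Longrightarrow> \<sigma> (t1, i) (t2, i)"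
      "monoid_ordering \<tau>"
    and u: "local_unit \<tau> u" and f: "f \<noteq> 0"
  shows "u *s f \<noteq> 0" "LT \<sigma> (u *s f) = LT \<sigma> f"
proof -
  define u' where "u' = u - 1"
  have split: "u *s f = f + u' *s f" by (simp add: u'_def fmod.scale_left_diff_distrib)
  have below: "\<sigma> w (LT \<sigma> f)" if w: "w \<in> supp (u' *s f)" for w
  proof -
    obtain t v where tv: "w = term_mult t v" "t \<in> Poly_Mapping.keys u'" "v \<in> supp f"
      by (rule supp_multE[OF w])
    have "t \<noteq> 0" "t \<in> Poly_Mapping.keys u"
      using tv(2) u by (auto simp: u'_def local_unit_def in_keys_iff lookup_minus lookup_one when_def split: if_splits)
    then have "\<tau> t 0" using u by (simp add: local_unit_def)
    then have "\<tau> (fst v + t) (fst v + 0)" using \<tau>(2) unfolding monoid_ordering_def by blast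
    then have "\<sigma> w v"
      using \<tau>(1)[of "fst v + t" "fst v" "snd v"] by (simp add: tv(1) term_mult_def add.commute)
    then show ?thesis using LT_greatest[OF mo f tv(3)] module_orderingD(5)[OF mo] by blast
  qed
  have "coeff (u' *s f) (LT \<sigma> f) = 0"
    using below[of "LT \<sigma> f"] module_orderingD(3)[OF mo, of "LT \<sigma> f"] by (auto simp: in_supp_iff)
  then have mem: "LT \<sigma> f \<in> supp (u *s f)"
    using LT_in_supp[OF mo f] by (simp add: split in_supp_iff)
  then show "u *s f \<noteq> 0" by auto
  show "LT \<sigma> (u *s f) = LT \<sigma> f"
  proof (rule LT_eqI[OF mo mem])
    fix w assume "w \<in> supp (u *s f)" "w \<noteq> LT \<sigma> f"
    then show "\<sigma> w (LT \<sigma> f)"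
      unfolding split using below LT_greatest[OF mo f] supp_add_subset by blast
  qed
qed

lemma pp_lcm_ge:
  "Poly_Mapping.lookup s x \<le> Poly_Mapping.lookup (pp_lcm s t) x"
  "Poly_Mapping.lookup t x \<le> Poly_Mapping.lookup (pp_lcm s t) x"
  by (simp_all add: pp_lcm.rep_eq)

lemma lcm_minus_plus:
  "pp_lcm s t - s + s = pp_lcm s t" "pp_lcm s t - t + t = pp_lcm s t"
  by (auto intro!: poly_mapping_eqI simp: lookup_add lookup_minus pp_lcm_ge)

definition S_pair_lifts :: "(('v, 'r) trm \<Rightarrow> ('v, 'r) trm \<Rightarrow> bool)
    \<Rightarrow> ('k::field, 'v, 'r::finite) fmod set \<Rightarrow> ('k, 'v, 'r) fmod \<Rightarrow> ('k, 'v, 'r) fmod \<Rightarrow> bool" where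
  "S_pair_lifts \<sigma> G U V \<longleftrightarrow>
     S_vector \<sigma> U V \<in> lower_sums \<sigma> G (pp_lcm (fst (LT \<sigma> U)) (fst (LT \<sigma> V)), snd (LT \<sigma> U))"

text \<open>
  Moving the expression for the S-vector to the other side gives a syzygy.  At the common
  product \<open>lcm\<close> only the two monomials from the S-vector itself remain, and the Schreyer ordering
  prefers the one at position \<open>j\<close>.
\<close>

lemma S_pair_syzygy:
  fixes gs :: "('k::field, 'v, 'r::finite) fmod list"
  assumes mo: "module_ordering \<sigma>" and nz: "0 \<notin> set gs"
    and ij: "i < j" "j < length gs" "snd (LT \<sigma> (gs ! i)) = snd (LT \<sigma> (gs ! j))"
    and lift: "S_pair_lifts \<sigma> (set gs) (gs ! i) (gs ! j)"
  defines "u \<equiv> (pp_lcm (fst (LT \<sigma> (gs ! i))) (fst (LT \<sigma> (gs ! j))) - fst (LT \<sigma> (gs ! j)), j)"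
  shows "\<exists>s. (\<forall>k\<ge>length gs. s k = 0) \<and> rep_eval gs s = 0 \<and> u \<in> rep_supp s \<and>
    (\<forall>w\<in>rep_supp s. w \<noteq> u \<longrightarrow> schreyer \<sigma> gs w u)"
proof -
  let ?ti = "fst (LT \<sigma> (gs ! i))" and ?tj = "fst (LT \<sigma> (gs ! j))"
  let ?B = "(pp_lcm ?ti ?tj, snd (LT \<sigma> (gs ! i)))"
  define p where "p = Poly_Mapping.single (pp_lcm ?ti ?tj - ?ti) (1 / LC \<sigma> (gs ! i))"
  define q where "q = Poly_Mapping.single (pp_lcm ?ti ?tj - ?tj) (1 / LC \<sigma> (gs ! j))"
  obtain h where h: "\<forall>k\<ge>length gs. h k = 0" "rep_eval gs h = S_vector \<sigma> (gs ! i) (gs ! j)"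
      "\<forall>w\<in>rep_supp h. \<sigma> (rep_term \<sigma> gs w) ?B"
    using lower_sums_rep lift unfolding S_pair_lifts_def by blast
  have gj: "gs ! j \<noteq> 0" using nz ij(2) nth_mem by metis
  have S: "S_vector \<sigma> (gs ! i) (gs ! j) = p *s gs ! i - q *s gs ! j"
    by (simp add: S_vector_def p_def q_def Let_def)
  define s where "s = (\<lambda>k. h k + ((q when k = j) - (p when k = i)))"
  have B: "rep_term \<sigma> gs u = ?B" "rep_term \<sigma> gs (pp_lcm ?ti ?tj - ?ti, i) = ?B"
    using ij(3) by (simp_all add: u_def rep_term_def term_mult_def lcm_minus_plus)
  have "u \<notin> rep_supp h" using h(3) B(1) module_orderingD(3)[OF mo] by metis
  then have "u \<in> rep_supp s"
    using ij(1) LC_nonzero[OF mo gj]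
    by (simp add: rep_supp_def s_def u_def q_def in_keys_iff lookup_add)
  moreover have "schreyer \<sigma> gs w u" if "w \<in> rep_supp s" "w \<noteq> u" for w
  proof (cases "w \<in> rep_supp h")
    case True
    then show ?thesis using h(3) B(1) by (simp add: schreyer_def)
  next
    case False
    then have "w = (pp_lcm ?ti ?tj - ?ti, i)"
      using that ij(1) by (cases w) (auto simp: rep_supp_def s_def u_def q_def p_def in_keys_iff lookup_add
        lookup_minus lookup_single when_def split: if_splits)
    then show ?thesis using B ij(1) by (simp add: schreyer_def u_def)
  qed
  moreover have "rep_eval gs s = 0"
    using ij by (simp add: s_def rep_eval_add rep_eval_diff rep_eval_unit h(2) S)
  moreover have "\<forall>k\<ge>length gs. s k = 0" using h(1) ij by (simp add: s_def)
  ultimately show ?thesis by blast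
qed

text \<open>
  \<open>X\<close> consists of the representations of all multiples \<open>u f\<close> by local units \<open>u\<close>, and \<open>S\<close> of the non-zero
  syzygies.  Suppose that, in the representation supplied by \<open>Mora_descent\<close>, the product at the leading
  term \<open>(t, j)\<close> also arose at a position \<open>i < j\<close>.  Then \<open>t\<close> would be divisible by the
  leading term of the syzygy of the pair \<open>(i, j)\<close>.  So the product arises only once and is the leading
  term of \<open>u f\<close>, which is that of \<open>f\<close>.
\<close>

theorem Buchberger_criterion:
  fixes gs :: "('k::field, 'v::finite, 'r::finite) fmod list"
  assumes mo: "module_ordering \<sigma>" and nz: "0 \<notin> set gs"
    and lift: "\<And>i j. i < j \<Longrightarrow> j < length gs \<Longrightarrow> snd (LT \<sigma> (gs ! i)) = snd (LT \<sigma> (gs ! j)) \<Longrightarrow>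
      S_pair_lifts \<sigma> (set gs) (gs ! i) (gs ! j)"
    and f: "f \<in> fmod.span (set gs)" "f \<noteq> 0"
  shows "\<exists>g\<in>set gs. term_dvd (LT \<sigma> g) (LT \<sigma> f)"
proof -
  obtain \<tau> where \<tau>: "\<And>t1 t2 i. \<tau> t1 t2 \<Longrightarrow> \<sigma> (t1, i) (t2, i)" "monoid_ordering \<tau>"
    using mo unfolding module_ordering_def by blast
  let ?rep = "\<lambda>r. \<forall>k\<ge>length gs. r k = (0 :: 'v pp \<Rightarrow>\<^sub>0 'k)"
  let ?\<rho> = "schreyer \<sigma> gs"
  note \<rho> = schreyer_ordering[OF mo, of gs]
  define X where "X = {r. ?rep r \<and> (\<exists>u. local_unit \<tau> u \<and> rep_eval gs r = u *s f)}"
  define S where "S = {s. ?rep s \<and> rep_eval gs s = 0 \<and> rep_supp s \<noteq> {}}"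
  define lead where "lead r = (SOME u. u \<in> rep_supp r \<and> (\<forall>w\<in>rep_supp r. w \<noteq> u \<longrightarrow> ?\<rho> w u))" for r :: "nat \<Rightarrow> 'v pp \<Rightarrow>\<^sub>0 'k"
  have lead_eq: "lead r = u" if "u \<in> rep_supp r" "\<forall>w\<in>rep_supp r. w \<noteq> u \<longrightarrow> ?\<rho> w u" for r u
    unfolding lead_def using that \<rho>(3) transpD[OF \<rho>(1)] by (intro some_equality) metis+
  have nonempty: "rep_supp r \<noteq> {}" if "r \<in> X" for r
  proof
    assume "rep_supp r = {}"
    then have "(t, k) \<notin> rep_supp r" for t k by simp
    then have "r k = 0" for k by (intro poly_mapping_eqI) (simp add: rep_supp_def in_keys_iff)
    then have "rep_eval gs r = 0" by (simp add: rep_eval_def)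
    then show False using that LT_local_unit_mult(1)[OF mo \<tau> _ f(2)] by (auto simp: X_def)
  qed
  have A: "finite (rep_supp y)" "snd ` rep_supp y \<subseteq> {..<length gs}" if "y \<in> X \<union> S" for y
    using that by (auto simp: X_def S_def dest: finite_rep_supp)
  have lead: "lead y \<in> rep_supp y \<and> (\<forall>w\<in>rep_supp y. w \<noteq> lead y \<longrightarrow> ?\<rho> w (lead y))" if "y \<in> X \<union> S" for y
  proof -
    have "rep_supp y \<noteq> {}" using that nonempty by (auto simp: S_def)
    from finite_total_order_max[OF A(1)[OF that] this \<rho>(1,2)] obtain u
      where u: "u \<in> rep_supp y" "\<forall>w\<in>rep_supp y. w \<noteq> u \<longrightarrow> ?\<rho> w u" by blast
    then show ?thesis using lead_eq[OF u] by simp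
  qed
  have red: "\<exists>r'\<in>X. rep_supp r' \<subseteq> (rep_supp r \<union> term_mult m ` rep_supp g) - {lead r}"
    if h: "r \<in> X" "g \<in> X \<union> S" "lead r = term_mult m (lead g)" "g \<in> S \<or> ?\<rho> (lead r) (lead g)" for r g m
  proof -
    define c where "c = Poly_Mapping.lookup (r (snd (lead r))) (fst (lead r))
      / Poly_Mapping.lookup (g (snd (lead g))) (fst (lead g))"
    let ?r' = "\<lambda>k. r k - Poly_Mapping.single m c * g k"
    have sub: "rep_supp ?r' \<subseteq> (rep_supp r \<union> term_mult m ` rep_supp g) - {lead r}"
      using rep_supp_diff_monomial_mult[of "lead g" g r m] lead[OF h(2)] by (simp add: h(3) c_def)
    obtain u where u: "local_unit \<tau> u" "rep_eval gs r = u *s f" using h(1) by (auto simp: X_def)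
    have rep: "?rep ?r'" using h(1,2) by (auto simp: X_def S_def)
    have eval: "rep_eval gs ?r' = u *s f - Poly_Mapping.single m c *s rep_eval gs g"
      by (simp add: rep_eval_diff rep_eval_scale u(2))
    have "\<exists>u'. local_unit \<tau> u' \<and> rep_eval gs ?r' = u' *s f"
    proof (cases "g \<in> S")
      case True
      then show ?thesis using u eval by (auto simp: S_def)
    next
      case False
      then obtain w where w: "local_unit \<tau> w" "rep_eval gs g = w *s f" using h(2) by (auto simp: X_def)
      (* Otherwise the multiple of g would not have a smaller leading term than g. *)
      have "\<tau> m 0"
      proof (rule ccontr)
        assume "\<not> \<tau> m 0"
        moreover have "m \<noteq> 0" using False h(3,4) \<rho>(3)[of "lead g"] by auto
        ultimately have "\<tau> 0 m" using \<tau>(2) by (auto simp: monoid_ordering_def totalp_on_def)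
        moreover define L where "L = rep_term \<sigma> gs (lead g)"
        ultimately have "\<tau> (fst L + 0) (fst L + m)" using \<tau>(2) unfolding monoid_ordering_def by blast
        then have "\<sigma> L (term_mult m L)"
          using \<tau>(1)[of "fst L" "fst L + m" "snd L"] by (simp add: term_mult_def add.commute)
        moreover have "\<sigma> (term_mult m L) L"
          using False h(3,4) by (simp add: schreyer_def rep_term_mult L_def)
        ultimately show False using module_orderingD(3,5)[OF mo] by blast
      qed
      then have "local_unit \<tau> (u - Poly_Mapping.single m c * w)"
        using local_unit_minus_smaller[OF \<tau>(2) u(1) w(1)] by simp
      moreover have "rep_eval gs ?r' = (u - Poly_Mapping.single m c * w) *s f"
        by (simp add: eval w(2) fmod.scale_left_diff_distrib)
      ultimately show ?thesis by blast
    qed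
    then have "?r' \<in> X" using rep by (simp add: X_def)
    then show ?thesis using sub by (intro bexI[of _ ?r'])
  qed
  obtain r0 where "?rep r0" "rep_eval gs r0 = 1 *s f" using span_rep[OF f(1)] by auto
  then have "X \<noteq> {}" using local_unit_one[of \<tau>] unfolding X_def by blast
  have "\<exists>r\<in>X. \<forall>s\<in>S. \<not> term_dvd (lead s) (lead r)"
    by (rule Mora_descent[OF \<rho>, where A = rep_supp and I = "{..<length gs}"])
      (use A lead red \<open>X \<noteq> {}\<close> in blast)+
  then obtain r where r: "r \<in> X" "\<forall>s\<in>S. \<not> term_dvd (lead s) (lead r)" by blast
  obtain t j where tj: "lead r = (t, j)" by (cases "lead r")
  have top: "(t, j) \<in> rep_supp r" "\<And>w. w \<in> rep_supp r \<Longrightarrow> w \<noteq> (t, j) \<Longrightarrow> ?\<rho> w (t, j)"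
    using lead[of r] r(1) by (auto simp: tj)
  have j: "j < length gs" using A(2)[of r] r(1) top(1) by auto
  have "\<sigma> (rep_term \<sigma> gs w) (rep_term \<sigma> gs (t, j))" if w: "w \<in> rep_supp r" "w \<noteq> (t, j)" for w
  proof (rule ccontr)
    assume "\<not> ?thesis"
    then have eq: "rep_term \<sigma> gs w = rep_term \<sigma> gs (t, j)" and i: "snd w < j"
      using top(2)[OF w] by (auto simp: schreyer_def)
    let ?i = "snd w"
    have comp: "snd (LT \<sigma> (gs ! ?i)) = snd (LT \<sigma> (gs ! j))"
      and prod: "fst w + fst (LT \<sigma> (gs ! ?i)) = t + fst (LT \<sigma> (gs ! j))"
      using eq by (simp_all add: rep_term_def term_mult_def)
    let ?u = "(pp_lcm (fst (LT \<sigma> (gs ! ?i))) (fst (LT \<sigma> (gs ! j))) - fst (LT \<sigma> (gs ! j)), j)"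
    obtain s where s: "?rep s" "rep_eval gs s = 0" "?u \<in> rep_supp s"
        "\<forall>w\<in>rep_supp s. w \<noteq> ?u \<longrightarrow> ?\<rho> w ?u"
      using S_pair_syzygy[OF mo nz i j comp lift[OF i j comp]] by blast
    have "Poly_Mapping.lookup (fst ?u) x \<le> Poly_Mapping.lookup t x" for x
    proof -
      have "Poly_Mapping.lookup (fst w + fst (LT \<sigma> (gs ! ?i))) x
          = Poly_Mapping.lookup (t + fst (LT \<sigma> (gs ! j))) x" by (simp add: prod)
      then show ?thesis by (simp add: lookup_add lookup_minus pp_lcm.rep_eq)
    qed
    then have "term_dvd ?u (t, j)" by (intro term_dvdI) simp_all
    moreover have "s \<in> S" using s by (auto simp: S_def)
    ultimately show False using r(2) lead_eq[OF s(3,4)] by (metis tj)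
  qed
  then have "LT \<sigma> (rep_eval gs r) = rep_term \<sigma> gs (t, j)"
    using r(1) top(1) by (intro LT_rep_eval[OF mo nz]) (auto simp: X_def)
  moreover obtain u where "local_unit \<tau> u" "rep_eval gs r = u *s f" using r(1) by (auto simp: X_def)
  ultimately have "LT \<sigma> f = term_mult t (LT \<sigma> (gs ! j))"
    using LT_local_unit_mult(2)[OF mo \<tau> _ f(2)] by (simp add: rep_term_def)
  then show ?thesis using j nth_mem unfolding term_dvd_def by blast
qed

lemma groebner_basis_of_S_pair_lifts:
  fixes gs :: "('k::field, 'v::finite, 'r::finite) fmod list"
  assumes mo: "module_ordering \<sigma>" and nz: "0 \<notin> set gs"
    and lift: "\<And>i j. i < j \<Longrightarrow> j < length gs \<Longrightarrow> snd (LT \<sigma> (gs ! i)) = snd (LT \<sigma> (gs ! j)) \<Longrightarrow>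
      S_pair_lifts \<sigma> (set gs) (gs ! i) (gs ! j)"
  shows "groebner_basis \<sigma> (set gs) (fmod.span (set gs))"
  unfolding groebner_basis_def
proof (intro conjI)
  let ?M = "fmod.span (set gs)" and ?tv = "\<lambda>v. term_vec (LT \<sigma> v) :: ('k, 'v, 'r) fmod"
  show sub: "set gs \<subseteq> ?M - {0}"
  proof
    fix g assume "g \<in> set gs"
    then show "g \<in> ?M - {0}" using nz fmod.span_base[of g "set gs"] by auto
  qed
  have "?tv ` set gs \<subseteq> fmod.span (?tv ` (?M - {0}))"
    using sub by (intro order_trans[OF _ fmod.span_superset] image_mono)
  moreover have "?tv ` (?M - {0}) \<subseteq> fmod.span (?tv ` set gs)"
  proof (rule image_subsetI)
    fix f assume "f \<in> ?M - {0}"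
    then have f: "f \<in> ?M" "f \<noteq> 0" by simp_all
    obtain g t where g: "g \<in> set gs" "LT \<sigma> f = term_mult t (LT \<sigma> g)"
      using Buchberger_criterion[OF mo nz lift f] unfolding term_dvd_def by blast
    have "term_vec (LT \<sigma> f) = (Poly_Mapping.single t 1 *s ?tv g)"
      by (simp add: g(2) term_vec_def vec_eq_iff axis_def mult_single)
    then show "term_vec (LT \<sigma> f) \<in> fmod.span (?tv ` set gs)"
      using fmod.span_scale[OF fmod.span_base[OF imageI[OF g(1)]]] by simp
  qed
  ultimately show "fmod.span (?tv ` set gs) = fmod.span (?tv ` (?M - {0}))"
    by (intro equalityI fmod.span_minimal fmod.subspace_span)
qed


section \<open>Gradings and the extended ordering\<close>

definition pp_degree :: "('m::finite, 'v::finite) zmat \<Rightarrow> 'v pp \<Rightarrow> 'm zvec" where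
  "pp_degree A t = A *v (\<chi> j. int (Poly_Mapping.lookup t j))"

lemma tdeg_term_mult: "tdeg A \<delta> (term_mult s u) = pp_degree A s + tdeg A \<delta> u"
proof -
  have "(\<chi> j. int (Poly_Mapping.lookup (s + fst u) j))
      = (\<chi> j. int (Poly_Mapping.lookup s j)) + (\<chi> j. int (Poly_Mapping.lookup (fst u) j))"
    by (simp add: vec_eq_iff lookup_add)
  then show ?thesis
    by (simp add: tdeg_def pp_degree_def matrix_vector_right_distrib algebra_simps)
qed

lemma lookup_map_key_Inr [simp]:
  "Poly_Mapping.lookup (Poly_Mapping.map_key Inr t) x = Poly_Mapping.lookup t (Inr x)"
  by (simp add: map_key.rep_eq)

text \<open>
  The block \<open>I\<^sub>m\<close> makes the exponents of the \<open>y\<^sub>k\<close> the difference of the two degrees; a term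
  of given degree is thus determined by its dehomogenization.
\<close>

lemma tdeg_ext:
  fixes u :: "('m::finite + 'n::finite, 'r) trm"
  shows "tdeg (ext_matrix W) \<delta> u $ k
    = int (Poly_Mapping.lookup (fst u) (Inl k)) + tdeg W \<delta> (deh_term u) $ k"
proof -
  have "(\<Sum>j\<in>UNIV. ext_matrix W $ k $ j * int (Poly_Mapping.lookup (fst u) j))
      = (\<Sum>i\<in>UNIV. mat 1 $ k $ i * int (Poly_Mapping.lookup (fst u) (Inl i)))
      + (\<Sum>j\<in>UNIV. W $ k $ j * int (Poly_Mapping.lookup (fst u) (Inr j)))"
    by (subst UNIV_Plus_UNIV[symmetric], subst sum.Plus) (simp_all add: ext_matrix_def)
  also have "(\<Sum>i\<in>UNIV. mat 1 $ k $ i * int (Poly_Mapping.lookup (fst u) (Inl i)))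
      = int (Poly_Mapping.lookup (fst u) (Inl k))"
    by (simp add: mat_def if_distrib[of "\<lambda>x. x * _"] cong: if_cong)
  finally show ?thesis
    by (simp add: tdeg_def matrix_vector_mult_def deh_term_def)
qed

lemma deh_term_term_mult:
  "deh_term (term_mult s u) = term_mult (Poly_Mapping.map_key Inr s) (deh_term u)"
  by (simp add: deh_term_def term_mult_def map_key_plus)

lemma snd_deh_term [simp]: "snd (deh_term u) = snd u"
  by (simp add: deh_term_def)

lemma term_eq_of_degree_deh:
  fixes u w :: "('m::finite + 'n::finite, 'r) trm"
  assumes "tdeg (ext_matrix W) \<delta> u = tdeg (ext_matrix W) \<delta> w" "deh_term u = deh_term w"
  shows "u = w"
proof (rule prod_eqI)
  show "snd u = snd w" using assms(2) by (simp add: deh_term_def)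
  show "fst u = fst w"
  proof (rule poly_mapping_eqI)
    fix x
    show "Poly_Mapping.lookup (fst u) x = Poly_Mapping.lookup (fst w) x"
    proof (cases x)
      case (Inl k)
      have "tdeg (ext_matrix W) \<delta> u $ k = tdeg (ext_matrix W) \<delta> w $ k" using assms(1) by simp
      then show ?thesis using assms(2) Inl unfolding tdeg_ext by simp
    next
      case (Inr j)
      have "Poly_Mapping.lookup (fst (deh_term u)) j = Poly_Mapping.lookup (fst (deh_term w)) j"
        using assms(2) by simp
      then show ?thesis using Inr by (simp add: deh_term_def)
    qed
  qed
qed

text \<open>
  Stated for strict total orders that are compatible with multiplication, because it is used twice:
  for the module ordering, and for the monoid ordering that belongs to it.
\<close>

lemma ext_ordering_strict_total:
  fixes W :: "('m::{finite,linorder}, 'n::finite) zmat"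
    and \<sigma> :: "('n, 'r) trm \<Rightarrow> ('n, 'r) trm \<Rightarrow> bool"
  assumes \<sigma>: "irreflp \<sigma>" "transp \<sigma>" "totalp \<sigma>"
    "\<And>s u w. \<sigma> u w \<Longrightarrow> \<sigma> (term_mult s u) (term_mult s w)"
  shows "irreflp (ext_ordering W \<delta> \<sigma>)" "transp (ext_ordering W \<delta> \<sigma>)" "totalp (ext_ordering W \<delta> \<sigma>)"
    "ext_ordering W \<delta> \<sigma> u w \<Longrightarrow> ext_ordering W \<delta> \<sigma> (term_mult s u) (term_mult s w)"
proof -
  show "irreflp (ext_ordering W \<delta> \<sigma>)"
    using \<sigma>(1) unfolding irreflp_def ext_ordering_def by (metis less_fun_irrefl)
  show "transp (ext_ordering W \<delta> \<sigma>)"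
    unfolding ext_ordering_def
    by (rule transpI, elim disjE conjE) (auto dest: less_fun_trans transpD[OF \<sigma>(2)])
  show "totalp (ext_ordering W \<delta> \<sigma>)"
  proof (rule totalpI)
    fix u w :: "('m + 'n, 'r) trm" assume "u \<noteq> w"
    let ?d = "tdeg (ext_matrix W) \<delta>"
    show "ext_ordering W \<delta> \<sigma> u w \<or> ext_ordering W \<delta> \<sigma> w u"
    proof (cases "?d u = ?d w")
      case True
      then have "deh_term u \<noteq> deh_term w" using \<open>u \<noteq> w\<close> term_eq_of_degree_deh by blast
      then show ?thesis using totalpD[OF \<sigma>(3)] True unfolding ext_ordering_def by metis
    next
      case False
      then have "($) (?d u) \<noteq> ($) (?d w)" by (auto simp: vec_eq_iff)
      then show ?thesis
        using less_fun_trichotomy[of "($) (?d u)" "($) (?d w)"] unfolding ext_ordering_def by auto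
    qed
  qed
  show "ext_ordering W \<delta> \<sigma> u w \<Longrightarrow> ext_ordering W \<delta> \<sigma> (term_mult s u) (term_mult s w)"
    unfolding ext_ordering_def tdeg_term_mult deh_term_term_mult
    by (elim disjE conjE) (simp_all add: less_fun_def \<sigma>(4))
qed

lemma module_ordering_ext:
  fixes W :: "('m::{finite,linorder}, 'n::finite) zmat"
    and \<sigma> :: "('n, 'r) trm \<Rightarrow> ('n, 'r) trm \<Rightarrow> bool"
  assumes mo: "module_ordering \<sigma>"
  shows "module_ordering (ext_ordering W \<delta> \<sigma>)"
proof -
  obtain \<tau> where \<tau>: "monoid_ordering \<tau>" "\<And>t1 t2 i. \<tau> t1 t2 \<Longrightarrow> \<sigma> (t1, i) (t2, i)"
    using mo unfolding module_ordering_def by blast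
  (* A monoid ordering is treated as an ordering of the terms of a module with one component. *)
  define \<tau>' :: "('n, unit) trm \<Rightarrow> ('n, unit) trm \<Rightarrow> bool" where "\<tau>' = (\<lambda>u w. \<tau> (fst u) (fst w))"
  have \<tau>': "irreflp \<tau>'" "transp \<tau>'" "totalp \<tau>'"
    "\<And>s u w. \<tau>' u w \<Longrightarrow> \<tau>' (term_mult s u) (term_mult s w)"
    using \<tau>(1) unfolding \<tau>'_def monoid_ordering_def
    by (auto simp: irreflp_def totalp_on_def prod_eq_iff intro!: transpI dest: transpD)
  note e = ext_ordering_strict_total[OF \<tau>', of W "\<lambda>_. 0"]
  define \<tau>e where "\<tau>e t1 t2 = ext_ordering W (\<lambda>_. 0) \<tau>' (t1, ()) (t2, ())" for t1 t2
  have "\<tau>e (s + t1) (s + t2)" if "\<tau>e t1 t2" for s t1 t2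
    using e(4)[of "(t1, ())" "(t2, ())" s] that by (simp add: \<tau>e_def term_mult_def)
  moreover have "irreflp \<tau>e" using e(1) by (simp add: \<tau>e_def irreflp_def)
  moreover have "transp \<tau>e" using transpD[OF e(2)] unfolding \<tau>e_def by (intro transpI)
  moreover have "totalp \<tau>e" using e(3) by (simp add: \<tau>e_def totalp_on_def)
  ultimately have mon: "monoid_ordering \<tau>e" by (simp add: monoid_ordering_def)
  have compat: "ext_ordering W \<delta> \<sigma> (t1, i) (t2, i)" if "\<tau>e t1 t2" for t1 t2 i
  proof -
    have shift: "tdeg (ext_matrix W) \<delta> (t, i) = tdeg (ext_matrix W) (\<lambda>_. 0) (t, ()) + \<delta> i" for t
      by (simp add: tdeg_def)
    have deh: "deh_term (t, j) = (Poly_Mapping.map_key Inr t, j)" for t j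
      by (simp add: deh_term_def)
    show ?thesis
      using that \<tau>(2) unfolding \<tau>e_def ext_ordering_def shift deh
      by (elim disjE conjE) (simp_all add: less_fun_def \<tau>'_def)
  qed
  have m: "irreflp \<sigma>" "transp \<sigma>" "totalp \<sigma>" "\<And>s u w. \<sigma> u w \<Longrightarrow> \<sigma> (term_mult s u) (term_mult s w)"
    using mo unfolding module_ordering_def by blast+
  note e' = ext_ordering_strict_total[OF m, of W \<delta>]
  show ?thesis unfolding module_ordering_def using e' mon compat by blast
qed

text \<open>
  The zero vector has every degree.
\<close>

definition has_degree :: "('m::finite, 'v::finite) zmat \<Rightarrow> ('r \<Rightarrow> 'm zvec) \<Rightarrow> 'm zvec
    \<Rightarrow> ('k::zero, 'v, 'r::finite) fmod \<Rightarrow> bool" where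
  "has_degree A \<delta> d v \<longleftrightarrow> (\<forall>u\<in>supp v. tdeg A \<delta> u = d)"

lemma homogeneous_iff: "homogeneous A \<delta> v \<longleftrightarrow> (\<exists>d. has_degree A \<delta> d v)"
  by (simp add: homogeneous_def has_degree_def)

lemma has_degree_diff:
  fixes v :: "('k::ab_group_add, 'v::finite, 'r::finite) fmod"
  shows "has_degree A \<delta> d v \<Longrightarrow> has_degree A \<delta> d w \<Longrightarrow> has_degree A \<delta> d (v - w)"
  unfolding has_degree_def using supp_diff_subset by blast

lemma has_degree_monomial_mult:
  fixes v :: "('k::field, 'v::finite, 'r::finite) fmod"
  assumes "homogeneous A \<delta> v" "u \<in> supp v" "tdeg A \<delta> (term_mult t u) = d"
  shows "has_degree A \<delta> d (Poly_Mapping.single t c *s v)"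
  unfolding has_degree_def
proof
  fix w assume "w \<in> supp (Poly_Mapping.single t c *s v)"
  then obtain s w' where w: "w = term_mult s w'" "s \<in> Poly_Mapping.keys (Poly_Mapping.single t c)" "w' \<in> supp v"
    by (rule supp_multE)
  have "s = t" using w(2) by (auto split: if_splits)
  moreover have "tdeg A \<delta> w' = tdeg A \<delta> u" using assms(1,2) w(3) by (auto simp: homogeneous_def)
  ultimately show "tdeg A \<delta> w = d" using assms(3) by (simp add: w(1) tdeg_term_mult)
qed

lemma coeff_hom_component:
  "coeff (hom_component A \<delta> d v) u = (coeff v u when tdeg A \<delta> u = d)"
  by (cases u) (auto simp: coeff_def hom_component_def lookup_mapp in_keys_iff when_def)

text \<open>
  Multiplying a homogeneous generator by a monomial gives a homogeneous vector, so each homogeneous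
  component of a combination of generators is again such a combination.
\<close>

lemma graded_submodule_span:
  fixes S :: "('k::field, 'v::finite, 'r::finite) fmod set"
  assumes hom: "\<forall>v\<in>S. homogeneous A \<delta> v"
  shows "graded_submodule A \<delta> (fmod.span S)"
  unfolding graded_submodule_def
proof (intro conjI ballI allI)
  show "fmod.subspace (fmod.span S)" by (rule fmod.subspace_span)
  fix v d assume "v \<in> fmod.span S"
  then show "hom_component A \<delta> d v \<in> fmod.span S"
  proof (induction rule: fmod.span_induct_alt)
    case base
    have "hom_component A \<delta> d (0 :: ('k, 'v, 'r) fmod) = 0"
      by (rule fmod_eqI) (simp add: coeff_hom_component)
    then show ?case by (simp add: fmod.span_zero)
  next
    case (step p x v)
    have monomial: "hom_component A \<delta> d (Poly_Mapping.single t c *s x) \<in> fmod.span S" for t c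
    proof (cases "x = 0")
      case True
      have "hom_component A \<delta> d (0 :: ('k, 'v, 'r) fmod) = 0"
        by (rule fmod_eqI) (simp add: coeff_hom_component)
      then show ?thesis by (simp add: True fmod.span_zero)
    next
      case False
      then obtain u where u: "u \<in> supp x" using supp_eq_empty_iff by blast
      have deg: "has_degree A \<delta> (tdeg A \<delta> (term_mult t u)) (Poly_Mapping.single t c *s x)"
        using hom step.hyps(1) u by (intro has_degree_monomial_mult) auto
      have "hom_component A \<delta> d (Poly_Mapping.single t c *s x)
          = (if tdeg A \<delta> (term_mult t u) = d then Poly_Mapping.single t c *s x else 0)"
      proof (rule fmod_eqI)
        fix w
        show "coeff (hom_component A \<delta> d (Poly_Mapping.single t c *s x)) w
            = coeff (if tdeg A \<delta> (term_mult t u) = d then Poly_Mapping.single t c *s x else 0) w"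
          using deg by (cases "w \<in> supp (Poly_Mapping.single t c *s x)")
            (auto simp: coeff_hom_component when_def has_degree_def in_supp_iff)
      qed
      then show ?thesis
        using fmod.span_scale[OF fmod.span_base[OF step.hyps(1)]] by (auto simp: fmod.span_zero)
    qed
    have "hom_component A \<delta> d (p *s x + v)
        = (\<Sum>t\<in>Poly_Mapping.keys p. hom_component A \<delta> d (Poly_Mapping.single t (Poly_Mapping.lookup p t) *s x))
          + hom_component A \<delta> d v"
      by (subst (1) monomial_decomposition[of p], rule fmod_eqI)
        (simp add: coeff_hom_component fmod.scale_sum_left coeff_sum when_def)
    then show ?case using step.IH monomial by (auto intro!: fmod.span_add fmod.span_sum)
  qed
qed


section \<open>Dehomogenization and homogenization\<close>

lemma coeff_axis_single:
  "coeff (axis i (Poly_Mapping.single t c)) u = (c when u = (t, i))"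
  by (cases u) (auto simp: coeff_def axis_def lookup_single when_def)

lemma sum_terms: "(\<Sum>u\<in>supp v. axis (snd u) (Poly_Mapping.single (fst u) (coeff v u))) = v"
  by (rule fmod_eqI) (auto simp: coeff_sum coeff_axis_single when_def in_supp_iff)

text \<open>
  Different terms may have the same dehomogenization.  Summation over any set containing the support
  makes \<open>deh\<close> visibly additive.
\<close>

lemma coeff_deh:
  assumes "finite A" "supp V \<subseteq> A"
  shows "coeff (deh V) w = (\<Sum>u\<in>A. coeff V u when deh_term u = w)"
proof -
  have "coeff (deh V) w = (\<Sum>u\<in>supp V. coeff V u when deh_term u = w)"
    unfolding deh_def coeff_sum
    by (intro sum.cong) (auto simp: coeff_axis_single when_def prod_eq_iff)
  also have "\<dots> = (\<Sum>u\<in>A. coeff V u when deh_term u = w)"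
    by (rule sum.mono_neutral_left[OF assms]) (auto simp: in_supp_iff)
  finally show ?thesis .
qed

lemma deh_add: "deh (U + V) = deh U + deh V"
proof (rule fmod_eqI)
  fix w
  have f: "finite (supp U \<union> supp V)" by simp
  show "coeff (deh (U + V)) w = coeff (deh U + deh V) w"
    by (simp add: coeff_deh[OF f supp_add_subset] coeff_deh[OF f Un_upper1] coeff_deh[OF f Un_upper2]
        sum.distrib[symmetric] when_add_distrib)
qed

lemma deh_zero [simp]: "deh 0 = 0"
  by (simp add: deh_def)

lemma deh_diff: "deh (U - V) = deh U - deh V"
  using deh_add[of "U - V" V] by simp

lemma deh_sum: "deh (sum f A) = (\<Sum>a\<in>A. deh (f a))"
  by (induction A rule: infinite_finite_induct) (auto simp: deh_add)

lemma deh_axis_single: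
  "deh (axis i (Poly_Mapping.single t c)) = axis i (Poly_Mapping.single (Poly_Mapping.map_key Inr t) c)"
proof (rule fmod_eqI)
  fix w
  have "supp (axis i (Poly_Mapping.single t c)) \<subseteq> {(t, i)}"
    by (auto simp: in_supp_iff coeff_axis_single when_def split: if_splits)
  then show "coeff (deh (axis i (Poly_Mapping.single t c))) w
      = coeff (axis i (Poly_Mapping.single (Poly_Mapping.map_key Inr t) c)) w"
    by (subst coeff_deh[of "{(t, i)}"]) (auto simp: coeff_axis_single deh_term_def when_def)
qed

lemma deh_monomial_mult:
  fixes V :: "('k::comm_ring_1, 'm + 'n, 'r::finite) fmod"
  shows "deh (Poly_Mapping.single m c *s V) = Poly_Mapping.single (Poly_Mapping.map_key Inr m) c *s deh V"
proof -
  have ax: "Poly_Mapping.single m c *s axis i (Poly_Mapping.single t b)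
      = (axis i (Poly_Mapping.single (m + t) (c * b)) :: ('k, 'x, 'r) fmod)" for m c t b i
    by (simp add: vec_eq_iff axis_def mult_single)
  have "Poly_Mapping.single m c *s V = (\<Sum>u\<in>supp V. axis (snd u) (Poly_Mapping.single (m + fst u) (c * coeff V u)))"
    by (subst (1) sum_terms[of V, symmetric]) (simp add: fmod.scale_sum_right ax)
  then have "deh (Poly_Mapping.single m c *s V) = (\<Sum>u\<in>supp V. axis (snd u)
      (Poly_Mapping.single (Poly_Mapping.map_key Inr m + Poly_Mapping.map_key Inr (fst u)) (c * coeff V u)))"
    by (simp only: deh_sum deh_axis_single map_key_plus[OF inj_Inr])
  then show ?thesis
    unfolding deh_def[of V] by (simp add: fmod.scale_sum_right ax deh_term_def)
qed

lemma lookup_y_times: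
  "Poly_Mapping.lookup (y_times a t) = case_sum (\<lambda>k. nat (a $ k)) (Poly_Mapping.lookup t)"
  unfolding y_times_def by (rule lookup_Abs_poly_mapping) simp

lemma map_key_y_times [simp]: "Poly_Mapping.map_key Inr (y_times a t) = t"
  by (rule poly_mapping_eqI) (simp add: lookup_y_times)

text \<open>
  Every polynomial in the \<open>x\<^sub>j\<close> is the dehomogenization of the same polynomial in the larger ring,
  so the image of a submodule is closed under multiplication.
\<close>

lemma deh_span:
  fixes S :: "('k::field, 'm::finite + 'n::finite, 'r::finite) fmod set"
  shows "deh ` fmod.span S = fmod.span (deh ` S)"
proof (intro equalityI subsetI)
  fix w assume "w \<in> deh ` fmod.span S"
  then obtain v where "v \<in> fmod.span S" "w = deh v" by blast
  then show "w \<in> fmod.span (deh ` S)"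
  proof (induction arbitrary: w rule: fmod.span_induct_alt)
    case base
    then show ?case by (simp add: fmod.span_zero)
  next
    case (step p x v)
    have "deh (p *s x) = (\<Sum>t\<in>Poly_Mapping.keys p.
        Poly_Mapping.single (Poly_Mapping.map_key Inr t) (Poly_Mapping.lookup p t) *s deh x)"
      by (subst (1) monomial_decomposition[of p])
        (simp add: fmod.scale_sum_left deh_sum deh_monomial_mult)
    then have "deh (p *s x) \<in> fmod.span (deh ` S)"
      using fmod.span_base[OF imageI[OF step.hyps(1)]] by (auto intro!: fmod.span_sum fmod.span_scale)
    then show ?case using step by (auto simp: deh_add intro!: fmod.span_add)
  qed
next
  fix w assume "w \<in> fmod.span (deh ` S)"
  then show "w \<in> deh ` fmod.span S"
  proof (induction rule: fmod.span_induct_alt)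
    case base
    then show ?case using fmod.span_zero by (metis deh_zero imageI)
  next
    case (step p x w)
    then obtain u v where uv: "u \<in> S" "x = deh u" "v \<in> fmod.span S" "w = deh v" by blast
    let ?p = "\<Sum>t\<in>Poly_Mapping.keys p. Poly_Mapping.single (y_times 0 t) (Poly_Mapping.lookup p t)"
    have "deh (?p *s u) = p *s x"
      by (subst (3) monomial_decomposition[of p])
        (simp add: uv(2) fmod.scale_sum_left deh_sum deh_monomial_mult)
    then have "p *s x + w = deh (?p *s u + v)" by (simp add: deh_add uv(4))
    moreover have "?p *s u + v \<in> fmod.span S"
      by (intro fmod.span_add fmod.span_scale fmod.span_base uv)
    ultimately show ?case by (rule image_eqI)
  qed
qed

context
  fixes W :: "('m::{finite,linorder}, 'n::finite) zmat" and \<delta> :: "'r::finite \<Rightarrow> 'm zvec"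
begin

text \<open>
  Within one degree dehomogenization is injective on terms, so nothing cancels.
\<close>

lemma supp_deh:
  fixes V :: "('k::field, 'm + 'n, 'r) fmod"
  assumes "has_degree (ext_matrix W) \<delta> d V"
  shows "supp (deh V) = deh_term ` supp V"
    and "u \<in> supp V \<Longrightarrow> coeff (deh V) (deh_term u) = coeff V u"
proof -
  have inj: "u = w" if "u \<in> supp V" "w \<in> supp V" "deh_term u = deh_term w" for u w
    using that assms term_eq_of_degree_deh[of W \<delta> u w] by (simp add: has_degree_def)
  show coeff: "coeff (deh V) (deh_term u) = coeff V u" if "u \<in> supp V" for u
  proof -
    have "coeff (deh V) (deh_term u) = (\<Sum>w\<in>supp V. coeff V w when w = u)"
      unfolding coeff_deh[OF finite_supp order_refl] using inj that
      by (intro sum.cong) (auto simp: when_def)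
    then show ?thesis using that by (simp add: when_def)
  qed
  show "supp (deh V) = deh_term ` supp V"
  proof (intro equalityI subsetI)
    fix w assume "w \<in> supp (deh V)"
    then have "(\<Sum>u\<in>supp V. coeff V u when deh_term u = w) \<noteq> 0"
      by (simp add: in_supp_iff coeff_deh[OF finite_supp order_refl])
    then obtain u where "u \<in> supp V" "(coeff V u when deh_term u = w) \<noteq> 0"
      by (meson sum.neutral)
    then show "w \<in> deh_term ` supp V" by (auto simp: when_def split: if_splits)
  qed (use coeff in \<open>auto simp: in_supp_iff\<close>)
qed

lemma deh_eq_zero_iff:
  fixes V :: "('k::field, 'm + 'n, 'r) fmod"
  assumes "has_degree (ext_matrix W) \<delta> d V"
  shows "deh V = 0 \<longleftrightarrow> V = 0"
  using supp_deh(1)[OF assms] by (metis image_is_empty supp_eq_empty_iff)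

lemma deh_inject:
  fixes U V :: "('k::field, 'm + 'n, 'r) fmod"
  assumes "has_degree (ext_matrix W) \<delta> d U" "has_degree (ext_matrix W) \<delta> d V" "deh U = deh V"
  shows "U = V"
  using deh_eq_zero_iff[OF has_degree_diff[OF assms(1,2)]] assms(3) by (simp add: deh_diff)

lemma ext_ordering_same_degree:
  assumes "tdeg (ext_matrix W) \<delta> u = tdeg (ext_matrix W) \<delta> w"
  shows "ext_ordering W \<delta> \<sigma> u w \<longleftrightarrow> \<sigma> (deh_term u) (deh_term w)"
  using assms by (simp add: ext_ordering_def less_fun_irrefl)

lemma LT_deh:
  fixes V :: "('k::field, 'm + 'n, 'r) fmod"
  assumes mo: "module_ordering \<sigma>" and V: "homogeneous (ext_matrix W) \<delta> V" "V \<noteq> 0"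
  shows "LT \<sigma> (deh V) = deh_term (LT (ext_ordering W \<delta> \<sigma>) V)"
    and "LC \<sigma> (deh V) = LC (ext_ordering W \<delta> \<sigma>) V"
    and "deh V \<noteq> 0"
proof -
  obtain d where d: "has_degree (ext_matrix W) \<delta> d V" using V(1) homogeneous_iff by blast
  let ?u = "LT (ext_ordering W \<delta> \<sigma>) V"
  note u = LT_in_supp[OF module_ordering_ext[OF mo] V(2), of W \<delta>]
    LT_greatest[OF module_ordering_ext[OF mo] V(2), of _ W \<delta>]
  show LT: "LT \<sigma> (deh V) = deh_term ?u"
  proof (rule LT_eqI[OF mo])
    show "deh_term ?u \<in> supp (deh V)" using u(1) supp_deh(1)[OF d] by blast
    fix w assume "w \<in> supp (deh V)" "w \<noteq> deh_term ?u"
    then obtain w' where w': "w = deh_term w'" "w' \<in> supp V" "w' \<noteq> ?u"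
      using supp_deh(1)[OF d] by blast
    then show "\<sigma> w (deh_term ?u)"
      using u(2)[OF w'(2,3)] u(1) d ext_ordering_same_degree[of w' ?u \<sigma>] by (simp add: has_degree_def)
  qed
  show "LC \<sigma> (deh V) = LC (ext_ordering W \<delta> \<sigma>) V"
    unfolding LC_def LT using supp_deh(2)[OF d u(1)] .
  show "deh V \<noteq> 0" using deh_eq_zero_iff[OF d] V(2) by simp
qed

lemma deh_homog:
  fixes v :: "('k::field, 'n, 'r) fmod"
  shows "deh (homog W \<delta> v) = v"
  by (simp add: homog_def deh_sum deh_axis_single sum_terms)

lemma has_degree_homog:
  fixes v :: "('k::field, 'n, 'r) fmod"
  shows "has_degree (ext_matrix W) \<delta> (top_deg W \<delta> v) (homog W \<delta> v)"
  unfolding has_degree_def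
proof
  fix u assume "u \<in> supp (homog W \<delta> v)"
  then obtain w where w: "w \<in> supp v"
      "u \<in> supp (axis (snd w) (Poly_Mapping.single (y_times (top_deg W \<delta> v - tdeg W \<delta> w) (fst w)) (coeff v w)))"
    unfolding homog_def using supp_sum_subset by blast
  then have u: "u = (y_times (top_deg W \<delta> v - tdeg W \<delta> w) (fst w), snd w)"
    by (auto simp: in_supp_iff coeff_axis_single when_def split: if_splits)
  have "tdeg W \<delta> w $ k \<le> top_deg W \<delta> v $ k" for k
    unfolding top_deg_def using w(1) by simp
  then show "tdeg (ext_matrix W) \<delta> u = top_deg W \<delta> v"
    by (simp add: vec_eq_iff tdeg_ext u deh_term_def lookup_y_times)
qed

lemma deh_saturation:
  fixes V :: "('k::field, 'm + 'n, 'r) fmod"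
  shows "deh (saturation W \<delta> V) = deh V"
  by (simp add: saturation_def deh_homog)

lemma homogeneous_saturation:
  fixes V :: "('k::field, 'm + 'n, 'r) fmod"
  shows "homogeneous (ext_matrix W) \<delta> (saturation W \<delta> V)"
  unfolding saturation_def homogeneous_iff using has_degree_homog by blast

text \<open>
  The degree of \<open>V\<close> is componentwise at least the degree of its saturation, which is the least degree
  in which the dehomogenization of \<open>V\<close> can be homogenized.  The power product in the \<open>y\<^sub>k\<close> with the
  difference as exponents makes the degrees equal, and homogeneous vectors of the same degree with the same
  dehomogenization coincide.
\<close>

lemma homogeneous_eq_y_saturation:
  fixes V :: "('k::field, 'm + 'n, 'r) fmod"
  assumes "homogeneous (ext_matrix W) \<delta> V"
  shows "\<exists>a. V = Poly_Mapping.single a 1 *s saturation W \<delta> V"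
proof (cases "V = 0")
  case True
  then show ?thesis by (simp add: saturation_def homog_def)
next
  case False
  obtain d where d: "has_degree (ext_matrix W) \<delta> d V" using assms homogeneous_iff by blast
  let ?S = "saturation W \<delta> V" and ?top = "top_deg W \<delta> (deh V)"
  define a where "a = (y_times (d - ?top) 0 :: ('m + 'n) pp)"
  have le: "?top $ k \<le> d $ k" for k
  proof -
    have "tdeg W \<delta> w $ k \<le> d $ k" if w: "w \<in> supp (deh V)" for w
    proof -
      obtain u where u: "u \<in> supp V" "w = deh_term u" using supp_deh(1)[OF d] w by blast
      then have "d $ k = tdeg (ext_matrix W) \<delta> u $ k" using d by (simp add: has_degree_def)
      then show ?thesis unfolding tdeg_ext u(2) by simp
    qed
    moreover have "supp (deh V) \<noteq> {}" using deh_eq_zero_iff[OF d] False by simp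
    ultimately show ?thesis unfolding top_deg_def by simp
  qed
  have "?S \<noteq> 0" using deh_saturation[of V] deh_eq_zero_iff[OF d] False by auto
  then obtain u where u: "u \<in> supp ?S" using supp_eq_empty_iff by blast
  have "tdeg (ext_matrix W) \<delta> u = ?top"
    using has_degree_homog[of "deh V"] u by (simp add: has_degree_def saturation_def)
  moreover have "pp_degree (ext_matrix W) a = d - ?top"
  proof -
    have "tdeg W (\<lambda>_::unit. 0) (0, ()) $ k = 0" for k
      by (simp add: tdeg_def matrix_vector_mult_def)
    then have "tdeg (ext_matrix W) (\<lambda>_::unit. 0) (a, ()) $ k = (d - ?top) $ k" for k
      unfolding tdeg_ext using le[of k] by (simp add: a_def deh_term_def lookup_y_times)
    then show ?thesis by (simp add: vec_eq_iff tdeg_def pp_degree_def)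
  qed
  ultimately have "tdeg (ext_matrix W) \<delta> (term_mult a u) = d" by (simp add: tdeg_term_mult)
  then have "has_degree (ext_matrix W) \<delta> d (Poly_Mapping.single a 1 *s ?S)"
    using has_degree_monomial_mult[OF homogeneous_saturation u] by blast
  moreover have "deh V = deh (Poly_Mapping.single a 1 *s ?S)"
    by (simp add: deh_monomial_mult deh_saturation a_def)
  ultimately show ?thesis using deh_inject[OF d] by blast
qed

lemma homogeneous_S_vector:
  fixes U V :: "('k::field, 'm + 'n, 'r) fmod"
  assumes mo: "module_ordering \<sigma>"
    and hom: "homogeneous (ext_matrix W) \<delta> U" "homogeneous (ext_matrix W) \<delta> V"
    and nz: "U \<noteq> 0" "V \<noteq> 0" and comp: "snd (LT \<sigma> U) = snd (LT \<sigma> V)"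
  shows "homogeneous (ext_matrix W) \<delta> (S_vector \<sigma> U V)"
proof -
  let ?l = "pp_lcm (fst (LT \<sigma> U)) (fst (LT \<sigma> V))"
  have "term_mult (?l - fst (LT \<sigma> U)) (LT \<sigma> U) = (?l, snd (LT \<sigma> U))"
    "term_mult (?l - fst (LT \<sigma> V)) (LT \<sigma> V) = (?l, snd (LT \<sigma> U))"
    using comp by (simp_all add: term_mult_def lcm_minus_plus)
  then show ?thesis
    unfolding homogeneous_iff S_vector_def Let_def
    using LT_in_supp[OF mo nz(1)] LT_in_supp[OF mo nz(2)]
    by (intro exI[of _ "tdeg (ext_matrix W) \<delta> (?l, snd (LT \<sigma> U))"] has_degree_diff
        has_degree_monomial_mult[OF hom(1)] has_degree_monomial_mult[OF hom(2)]) auto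
qed

lemma deh_S_vector:
  fixes U V :: "('k::field, 'm + 'n, 'r) fmod"
  assumes mo: "module_ordering \<sigma>"
    and hom: "homogeneous (ext_matrix W) \<delta> U" "homogeneous (ext_matrix W) \<delta> V"
    and nz: "U \<noteq> 0" "V \<noteq> 0"
  shows "deh (S_vector (ext_ordering W \<delta> \<sigma>) U V) = S_vector \<sigma> (deh U) (deh V)"
proof -
  have "Poly_Mapping.map_key Inr (pp_lcm s t - s') =
      pp_lcm (Poly_Mapping.map_key Inr s) (Poly_Mapping.map_key Inr t) - Poly_Mapping.map_key Inr s'"
    for s t s' :: "('m + 'n) pp"
    by (rule poly_mapping_eqI) (simp add: lookup_minus pp_lcm.rep_eq)
  then show ?thesis
    by (simp add: S_vector_def Let_def deh_diff deh_monomial_mult LT_deh(1,2)[OF mo hom(1) nz(1)]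
        LT_deh(1,2)[OF mo hom(2) nz(2)] deh_term_def)
qed

end


section \<open>Saturating remainders\<close>

text \<open>
  The two multiples have the least common multiple as leading term with coefficient \<open>1\<close> each, and
  these cancel.
\<close>

lemma S_vector_below:
  fixes U V :: "('k::field, 'v, 'r::finite) fmod"
  assumes mo: "module_ordering \<sigma>" and nz: "U \<noteq> 0" "V \<noteq> 0" and comp: "snd (LT \<sigma> U) = snd (LT \<sigma> V)"
    and u: "u \<in> supp (S_vector \<sigma> U V)"
  shows "\<sigma> u (pp_lcm (fst (LT \<sigma> U)) (fst (LT \<sigma> V)), snd (LT \<sigma> U))"
proof -
  let ?l = "pp_lcm (fst (LT \<sigma> U)) (fst (LT \<sigma> V))"
  let ?B = "(?l, snd (LT \<sigma> U))"
  define p where "p = Poly_Mapping.single (?l - fst (LT \<sigma> U)) (1 / LC \<sigma> U)"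
  define q where "q = Poly_Mapping.single (?l - fst (LT \<sigma> V)) (1 / LC \<sigma> V)"
  have S: "S_vector \<sigma> U V = p *s U - q *s V" by (simp add: S_vector_def p_def q_def Let_def)
  have B: "?B = term_mult (?l - fst (LT \<sigma> U)) (LT \<sigma> U)" "?B = term_mult (?l - fst (LT \<sigma> V)) (LT \<sigma> V)"
    using comp by (simp_all add: term_mult_def lcm_minus_plus)
  have LC: "LC \<sigma> U \<noteq> 0" "LC \<sigma> V \<noteq> 0" using LC_nonzero[OF mo] nz by auto
  have "coeff (p *s U) ?B = 1"
    unfolding B(1) p_def using LC(1) by (simp add: LC_def)
  moreover have "coeff (q *s V) ?B = 1"
    unfolding B(2) q_def using LC(2) by (simp add: LC_def)
  ultimately have coeff: "coeff (p *s U) ?B = 1" "coeff (q *s V) ?B = 1" .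
  then have "u \<noteq> ?B" using u by (auto simp: S in_supp_iff)
  have LT: "LT \<sigma> (p *s U) = ?B" "LT \<sigma> (q *s V) = ?B"
    unfolding p_def q_def
    using LT_monomial_mult[OF mo nz(1), of "1 / LC \<sigma> U" "?l - fst (LT \<sigma> U)"]
      LT_monomial_mult[OF mo nz(2), of "1 / LC \<sigma> V" "?l - fst (LT \<sigma> V)"] LC B by simp_all
  have nz': "p *s U \<noteq> 0" "q *s V \<noteq> 0"
    using coeff by auto
  have "u \<in> supp (p *s U) \<union> supp (q *s V)" using u supp_diff_subset unfolding S by blast
  then show ?thesis
    using LT_greatest[OF mo nz'(1)] LT_greatest[OF mo nz'(2)] \<open>u \<noteq> ?B\<close> unfolding LT by blast
qed

lemma monomial_mult_below:
  fixes V :: "('k::field, 'v, 'r::finite) fmod"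
  assumes mo: "module_ordering \<sigma>" and V: "V \<noteq> 0" and top: "\<sigma> (term_mult t (LT \<sigma> V)) B"
    and u: "u \<in> supp (Poly_Mapping.single t c *s V)"
  shows "\<sigma> u B"
proof -
  have "c \<noteq> 0" using u by auto
  then obtain w where w: "u = term_mult t w" "w \<in> supp V" using u supp_monomial_mult[of c t V] by blast
  have "w = LT \<sigma> V \<or> \<sigma> w (LT \<sigma> V)" using LT_greatest[OF mo V w(2)] by blast
  then have "u = term_mult t (LT \<sigma> V) \<or> \<sigma> u (term_mult t (LT \<sigma> V))"
    using module_orderingD(4)[OF mo] w(1) by blast
  then show ?thesis using top module_orderingD(5)[OF mo] by blast
qed

lemma span_insert_redundant:
  fixes a :: "('k::field, 'v, 'r::finite) fmod"
  assumes "a \<in> fmod.span S"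
  shows "fmod.span (insert a S) = fmod.span S"
  unfolding fmod.span_eq using assms fmod.span_superset[of S] fmod.span_superset[of "insert a S"] by blast

context
  fixes W :: "('m::{finite,linorder}, 'n::finite) zmat" and \<delta> :: "'r::finite \<Rightarrow> 'm zvec"
    and \<sigma> :: "('n, 'r) trm \<Rightarrow> ('n, 'r) trm \<Rightarrow> bool"
  assumes mo: "module_ordering \<sigma>"
begin

abbreviation (input) hom :: "('k::field, 'm + 'n, 'r) fmod \<Rightarrow> bool" where
  "hom V \<equiv> homogeneous (ext_matrix W) \<delta> V"

abbreviation (input) sigma_bar :: "('m + 'n, 'r) trm \<Rightarrow> ('m + 'n, 'r) trm \<Rightarrow> bool" where
  "sigma_bar \<equiv> ext_ordering W \<delta> \<sigma>"

lemmas mo_bar = module_ordering_ext[OF mo, of W \<delta>]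

lemma reducesE:
  fixes G :: "('k::field, 'm + 'n, 'r) fmod list"
  assumes "reduces sigma_bar G Q R" "\<forall>V\<in>set G. hom V"
  obtains V c t where "V \<in> set G" "V \<noteq> 0" "R = Q - Poly_Mapping.single t c *s V"
    "term_mult t (LT sigma_bar V) \<in> supp Q"
    "\<forall>d. has_degree (ext_matrix W) \<delta> d Q \<longrightarrow> has_degree (ext_matrix W) \<delta> d R"
proof -
  obtain V c t where V: "V \<in> set G" "V \<noteq> 0" "R = Q - Poly_Mapping.single t c *s V"
    "term_mult t (LT sigma_bar V) \<in> supp Q"
    using assms(1) unfolding reduces_def by blast
  have "has_degree (ext_matrix W) \<delta> d R" if "has_degree (ext_matrix W) \<delta> d Q" for d
    unfolding V(3)
  proof (rule has_degree_diff[OF that])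
    show "has_degree (ext_matrix W) \<delta> d (Poly_Mapping.single t c *s V)"
      using assms(2) V(1,4) that LT_in_supp[OF mo_bar V(2)]
      by (intro has_degree_monomial_mult[of _ _ V "LT sigma_bar V"]) (auto simp: has_degree_def)
  qed
  with V that show thesis by blast
qed

lemma homogeneous_reduces:
  fixes G :: "('k::field, 'm + 'n, 'r) fmod list"
  assumes "(reduces sigma_bar G)\<^sup>*\<^sup>* Q R" "\<forall>V\<in>set G. hom V" "hom Q"
  shows "hom R"
  using assms(1)
proof (induction rule: rtranclp_induct)
  case (step R R')
  obtain d where "has_degree (ext_matrix W) \<delta> d R" using step.IH homogeneous_iff by blast
  then show ?case using reducesE[OF step.hyps(2) assms(2)] homogeneous_iff by metis
qed (rule assms(3))

text \<open>
  Dehomogenization turns the steps into division steps or into equalities.  In a division step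
  the leading term of the subtracted multiple occurs in the current vector, so it inherits every
  strict upper bound \<open>B\<close> of the terms.
\<close>

lemma weak_sat_steps:
  fixes G :: "('k::field, 'm + 'n, 'r) fmod list"
  assumes "(weak_sat_step W \<delta> \<sigma> G)\<^sup>*\<^sup>* Q R" "\<forall>V\<in>set G. hom V" "hom Q"
  shows "hom R" "deh Q - deh R \<in> fmod.span (deh ` set G)"
    "(\<forall>u\<in>supp (deh Q). \<sigma> u B) \<Longrightarrow>
      deh Q - deh R \<in> lower_sums \<sigma> (deh ` set G) B \<and> (\<forall>u\<in>supp (deh R). \<sigma> u B)"
proof -
  have "hom R \<and> deh Q - deh R \<in> fmod.span (deh ` set G) \<and> ((\<forall>u\<in>supp (deh Q). \<sigma> u B) \<longrightarrow>
      deh Q - deh R \<in> lower_sums \<sigma> (deh ` set G) B \<and> (\<forall>u\<in>supp (deh R). \<sigma> u B))"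
    using assms(1)
  proof (induction rule: rtranclp_induct)
    case base
    then show ?case using assms(3) by (simp add: fmod.span_zero lower_sums.zero)
  next
    case (step R R')
    show ?case
    proof (cases "hom R' \<and> saturation W \<delta> R' = saturation W \<delta> R")
      case True
      then have "deh R' = deh R" by (metis deh_saturation)
      then show ?thesis using step.IH True by simp
    next
      case False
      then have red: "reduces sigma_bar G R R'" using step.hyps(2) unfolding weak_sat_step_def by blast
      obtain V c t where V: "V \<in> set G" "V \<noteq> 0" "R' = R - Poly_Mapping.single t c *s V"
        "term_mult t (LT sigma_bar V) \<in> supp R"
        "\<forall>d. has_degree (ext_matrix W) \<delta> d R \<longrightarrow> has_degree (ext_matrix W) \<delta> d R'"
        by (rule reducesE[OF red assms(2)])
      obtain d where d: "has_degree (ext_matrix W) \<delta> d R" using step.IH homogeneous_iff by blast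
      define s where "s = Poly_Mapping.map_key Inr t"
      have homV: "hom V" using assms(2) V(1) by blast
      have deh: "deh R' = deh R - Poly_Mapping.single s c *s deh V"
        by (simp add: V(3) deh_diff deh_monomial_mult s_def)
      then have eq: "deh Q - deh R' = (deh Q - deh R) + Poly_Mapping.single s c *s deh V" by simp
      have top: "term_mult s (LT \<sigma> (deh V)) \<in> supp (deh R)"
        using imageI[OF V(4), of deh_term] supp_deh(1)[OF d]
        by (simp add: deh_term_term_mult LT_deh(1)[OF mo homV V(2)] s_def)
      have "hom R'" using V(5) d homogeneous_iff by blast
      moreover have "deh Q - deh R' \<in> fmod.span (deh ` set G)"
        unfolding eq using step.IH fmod.span_scale[OF fmod.span_base[OF imageI[OF V(1)]]]
        by (blast intro: fmod.span_add)
      moreover have "deh Q - deh R' \<in> lower_sums \<sigma> (deh ` set G) B \<and> (\<forall>u\<in>supp (deh R'). \<sigma> u B)"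
        if "\<forall>u\<in>supp (deh Q). \<sigma> u B"
      proof
        have IH: "deh Q - deh R \<in> lower_sums \<sigma> (deh ` set G) B" "\<forall>u\<in>supp (deh R). \<sigma> u B"
          using step.IH that by auto
        show "deh Q - deh R' \<in> lower_sums \<sigma> (deh ` set G) B"
          unfolding eq using IH V(1) top by (intro lower_sums.add) auto
        show "\<forall>u\<in>supp (deh R'). \<sigma> u B"
        proof
          fix u assume "u \<in> supp (deh R')"
          then have "u \<in> supp (deh R) \<or> u \<in> supp (Poly_Mapping.single s c *s deh V)"
            unfolding deh using supp_diff_subset by blast
          then show "\<sigma> u B"
          proof
            assume "u \<in> supp (Poly_Mapping.single s c *s deh V)"
            then show ?thesis
              using monomial_mult_below[OF mo LT_deh(3)[OF mo homV V(2)]] IH(2) top by blast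
          qed (use IH(2) in blast)
        qed
      qed
      ultimately show ?thesis by blast
    qed
  qed
  then show "hom R" "deh Q - deh R \<in> fmod.span (deh ` set G)"
    "(\<forall>u\<in>supp (deh Q). \<sigma> u B) \<Longrightarrow>
      deh Q - deh R \<in> lower_sums \<sigma> (deh ` set G) B \<and> (\<forall>u\<in>supp (deh R). \<sigma> u B)" by blast+
qed

text \<open>
  Saturating is one more step of the weak algorithm.  The result stays irreducible because its leading
  term divides that of the vector which is saturated.
\<close>

lemma sat_remainder_imp_weak:
  fixes G :: "('k::field, 'm + 'n, 'r) fmod list"
  assumes "sat_remainder W \<delta> \<sigma> G Q V" "\<forall>V\<in>set G. hom V" "hom Q"
  shows "weak_sat_remainder W \<delta> \<sigma> G Q V"
proof -
  obtain R where R: "(reduces sigma_bar G)\<^sup>*\<^sup>* Q R" "lead_irreducible sigma_bar G R"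
      "V = saturation W \<delta> R"
    using assms(1) by (auto simp: sat_remainder_def remainder_def)
  have homR: "hom R" using homogeneous_reduces[OF R(1) assms(2,3)] .
  have "(weak_sat_step W \<delta> \<sigma> G)\<^sup>*\<^sup>* Q R"
    by (rule mono_rtranclp[rule_format, OF _ R(1)]) (simp add: weak_sat_step_def)
  moreover have "weak_sat_step W \<delta> \<sigma> G R V"
    unfolding weak_sat_step_def R(3) using homogeneous_saturation[of W \<delta> R]
    by (simp add: saturation_def deh_homog)
  ultimately have steps: "(weak_sat_step W \<delta> \<sigma> G)\<^sup>*\<^sup>* Q V" by simp
  obtain a where a: "R = Poly_Mapping.single a 1 *s V"
    using homogeneous_eq_y_saturation[OF homR] R(3) by blast
  have "lead_irreducible sigma_bar G V"
  proof (cases "V = 0")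
    case False
    have LT: "LT sigma_bar R = term_mult a (LT sigma_bar V)"
      unfolding a by (rule LT_monomial_mult[OF mo_bar False]) simp
    have "R \<noteq> 0" using False R(3) by (auto simp: saturation_def homog_def)
    then show ?thesis
      using R(2) term_dvd_trans[of _ "LT sigma_bar V" "LT sigma_bar R"] LT
      unfolding lead_irreducible_def term_dvd_def[of "LT sigma_bar V"] by blast
  qed (simp add: lead_irreducible_def)
  with steps show ?thesis by (simp add: weak_sat_remainder_def)
qed

lemma weak_sat_remainder_lower:
  fixes G :: "('k::field, 'm + 'n, 'r) fmod list"
  assumes rem: "weak_sat_remainder W \<delta> \<sigma> G Q V" and G: "\<forall>V\<in>set G. hom V" and Q: "hom Q"
    and B: "\<forall>u\<in>supp (deh Q). \<sigma> u B"
  shows "deh Q \<in> lower_sums \<sigma> (deh ` (set G \<union> ({V} - {0}))) B"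
proof -
  have steps: "(weak_sat_step W \<delta> \<sigma> G)\<^sup>*\<^sup>* Q V" using rem by (simp add: weak_sat_remainder_def)
  note s = weak_sat_steps[OF steps G Q]
  have low: "deh Q - deh V \<in> lower_sums \<sigma> (deh ` (set G \<union> ({V} - {0}))) B"
    using s(3)[OF B] by (auto intro: lower_sums_mono[rotated])
  show ?thesis
  proof (cases "V = 0")
    case False
    have "\<sigma> (term_mult 0 (LT \<sigma> (deh V))) B"
      using s(3)[OF B] LT_in_supp[OF mo LT_deh(3)[OF mo s(1) False]] by simp
    then have "deh Q - deh V + Poly_Mapping.single 0 1 *s deh V
        \<in> lower_sums \<sigma> (deh ` (set G \<union> ({V} - {0}))) B"
      using False by (intro lower_sums.add low) auto
    then show ?thesis by simp
  qed (use low in simp)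
qed

text \<open>
  The division accounts for \<open>Q - R\<close>, and \<open>R\<close> is a multiple of its saturation, which belongs to the enlarged set.
\<close>

lemma sat_remainder_lower:
  fixes G :: "('k::field, 'm + 'n, 'r) fmod list"
  assumes rem: "sat_remainder W \<delta> \<sigma> G Q V" and G: "\<forall>V\<in>set G. hom V" and Q: "hom Q"
    and B: "\<forall>u\<in>supp Q. sigma_bar u B"
  shows "Q \<in> lower_sums sigma_bar (set G \<union> ({V} - {0})) B"
proof -
  obtain R where R: "(reduces sigma_bar G)\<^sup>*\<^sup>* Q R" "V = saturation W \<delta> R"
    using rem by (auto simp: sat_remainder_def remainder_def)
  have homR: "hom R" using homogeneous_reduces[OF R(1) G Q] .
  have "Q - R \<in> lower_sums sigma_bar (set G) B \<and> (\<forall>u\<in>supp R. sigma_bar u B)"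
    using R(1)
  proof (induction rule: rtranclp_induct)
    case base
    then show ?case using B by (simp add: lower_sums.zero)
  next
    case (step R R')
    obtain V c t where V: "V \<in> set G" "V \<noteq> 0" "R' = R - Poly_Mapping.single t c *s V"
      "term_mult t (LT sigma_bar V) \<in> supp R"
      using step.hyps(2) unfolding reduces_def by blast
    have top: "sigma_bar (term_mult t (LT sigma_bar V)) B" using step.IH V(4) by blast
    have "(Q - R) + Poly_Mapping.single t c *s V \<in> lower_sums sigma_bar (set G) B"
      using step.IH V(1) top by (intro lower_sums.add) auto
    moreover have "sigma_bar u B" if "u \<in> supp R'" for u
    proof -
      have "u \<in> supp R \<or> u \<in> supp (Poly_Mapping.single t c *s V)"
        using that unfolding V(3) using supp_diff_subset by blast
      then show ?thesis
      proof
        assume "u \<in> supp (Poly_Mapping.single t c *s V)"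
        then show ?thesis by (rule monomial_mult_below[OF mo_bar V(2) top])
      qed (use step.IH in blast)
    qed
    ultimately show ?case by (simp add: V(3) algebra_simps)
  qed
  then have low: "Q - R \<in> lower_sums sigma_bar (set G \<union> ({V} - {0})) B" "\<forall>u\<in>supp R. sigma_bar u B"
    by (auto intro: lower_sums_mono[rotated])
  obtain a where a: "R = Poly_Mapping.single a 1 *s V"
    using homogeneous_eq_y_saturation[OF homR] R(2) by blast
  show ?thesis
  proof (cases "V = 0")
    case True
    then show ?thesis using low(1) a by simp
  next
    case False
    have "R \<noteq> 0" using False R(2) by (auto simp: saturation_def homog_def)
    moreover have "LT sigma_bar R = term_mult a (LT sigma_bar V)"
      unfolding a by (rule LT_monomial_mult[OF mo_bar False]) simp
    ultimately have "sigma_bar (term_mult a (LT sigma_bar V)) B"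
      using low(2) LT_in_supp[OF mo_bar, of R] by simp
    then have "Q - R + Poly_Mapping.single a 1 *s V \<in> lower_sums sigma_bar (set G \<union> ({V} - {0})) B"
      using False by (intro lower_sums.add low(1)) auto
    then show ?thesis using a by simp
  qed
qed

text \<open>
  All vectors that occur have the degree of \<open>Q\<close>; in this degree \<open>\<sigma>\<close>-bar agrees with \<open>\<sigma>\<close> on dehomogenized
  terms, so the leading terms cannot decrease forever.
\<close>

lemma remainder_exists:
  fixes G :: "('k::field, 'm + 'n, 'r) fmod list"
  assumes wf: "wfp \<sigma>" and G: "\<forall>V\<in>set G. hom V" and Q: "hom Q"
  shows "\<exists>R. remainder sigma_bar G Q R"
  using Q
proof (induction "deh_term (LT sigma_bar Q)" arbitrary: Q rule: wfp_induct_rule[OF wf])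
  case (1 Q)
  show ?case
  proof (cases "lead_irreducible sigma_bar G Q")
    case True
    then show ?thesis unfolding remainder_def by blast
  next
    case False
    then obtain V t where V: "Q \<noteq> 0" "V \<in> set G" "V \<noteq> 0" "LT sigma_bar Q = term_mult t (LT sigma_bar V)"
      unfolding lead_irreducible_def term_dvd_def by blast
    define c where "c = LC sigma_bar Q / LC sigma_bar V"
    define R where "R = Q - Poly_Mapping.single t c *s V"
    have LC: "LC sigma_bar Q \<noteq> 0" "LC sigma_bar V \<noteq> 0" using LC_nonzero[OF mo_bar] V(1,3) by blast+
    have "coeff (Poly_Mapping.single t c *s V) (LT sigma_bar Q) = c * LC sigma_bar V"
      unfolding V(4) by (simp add: LC_def)
    then have notin: "LT sigma_bar Q \<notin> supp R"
      using LC by (simp add: R_def in_supp_iff c_def) (simp add: LC_def)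
    have red: "reduces sigma_bar G Q R"
      unfolding reduces_def using V notin R_def LT_in_supp[OF mo_bar V(1)] by metis
    obtain d where d: "has_degree (ext_matrix W) \<delta> d Q" using 1(2) homogeneous_iff by blast
    have d': "has_degree (ext_matrix W) \<delta> d R" by (rule reducesE[OF red G]) (use d in blast)
    have "\<exists>R'. remainder sigma_bar G R R'"
    proof (cases "R = 0")
      case True
      then show ?thesis unfolding remainder_def lead_irreducible_def by blast
    next
      case False
      have in_R: "LT sigma_bar R \<in> supp R" using LT_in_supp[OF mo_bar False] .
      have "sigma_bar (LT sigma_bar R) (LT sigma_bar Q)"
      proof (cases "LT sigma_bar R \<in> supp Q")
        case True
        then show ?thesis using LT_greatest[OF mo_bar V(1)] in_R notin by metis
      next
        case False
        then have mem: "LT sigma_bar R \<in> supp (Poly_Mapping.single t c *s V)"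
          using in_R supp_diff_subset unfolding R_def by blast
        have c: "c \<noteq> 0" using LC by (simp add: c_def)
        then have LT: "LT sigma_bar (Poly_Mapping.single t c *s V) = LT sigma_bar Q"
          using LT_monomial_mult[OF mo_bar V(3)] V(4) by simp
        have "Poly_Mapping.single t c *s V \<noteq> 0" using mem by auto
        then show ?thesis using LT_greatest[OF mo_bar _ mem] LT in_R notin by metis
      qed
      moreover have "tdeg (ext_matrix W) \<delta> (LT sigma_bar R) = tdeg (ext_matrix W) \<delta> (LT sigma_bar Q)"
        using d d' in_R LT_in_supp[OF mo_bar V(1)] by (simp add: has_degree_def)
      ultimately have "\<sigma> (deh_term (LT sigma_bar R)) (deh_term (LT sigma_bar Q))"
        using ext_ordering_same_degree by blast
      then show ?thesis using 1(1) d' homogeneous_iff by blast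
    qed
    then show ?thesis unfolding remainder_def using red by (meson converse_rtranclp_into_rtranclp)
  qed
qed


section \<open>Invariants of the algorithm\<close>

text \<open>
  No leading term in \<open>G\<close> is divisible by an earlier one: this part gives termination.
\<close>

definition bb_shape :: "('k::field, 'm + 'n, 'r) bstate \<Rightarrow> bool" where
  "bb_shape s \<longleftrightarrow> (case s of (gens, prs, G) \<Rightarrow>
     (\<forall>Q\<in>#gens. hom Q) \<and> (\<forall>V\<in>set G. hom V \<and> V \<noteq> 0) \<and> finite prs \<and>
     (\<forall>i j. (i, j) \<in> prs \<longrightarrow> i < j \<and> j < length G \<and> snd (LT sigma_bar (G ! i)) = snd (LT sigma_bar (G ! j))) \<and>
     (\<forall>i j. i < j \<and> j < length G \<longrightarrow> \<not> term_dvd (LT sigma_bar (G ! i)) (LT sigma_bar (G ! j))))"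

text \<open>
  The quantity that every round preserves; at the start it is the dehomogenization of \<open>N\<close>.
\<close>

definition bb_span :: "('k::field, 'm + 'n, 'r) bstate \<Rightarrow> ('k, 'n, 'r) fmod set" where
  "bb_span s = (case s of (gens, prs, G) \<Rightarrow> fmod.span (deh ` (set_mset gens \<union> set G)))"

text \<open>
  \<open>\<Psi> G U V\<close> is the lifting condition for the pair \<open>(U, V)\<close>, in \<open>F\<close> for the weak variant and in the extended
  module for the saturating one.
\<close>

definition bb_pairs :: "(('k::field, 'm + 'n, 'r) fmod set \<Rightarrow> ('k, 'm + 'n, 'r) fmod \<Rightarrow> ('k, 'm + 'n, 'r) fmod \<Rightarrow> bool)
    \<Rightarrow> ('k, 'm + 'n, 'r) bstate \<Rightarrow> bool" where
  "bb_pairs \<Psi> s \<longleftrightarrow> (case s of (gens, prs, G) \<Rightarrow>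
     (\<forall>i j. i < j \<and> j < length G \<and> snd (LT sigma_bar (G ! i)) = snd (LT sigma_bar (G ! j)) \<and> (i, j) \<notin> prs
        \<longrightarrow> \<Psi> (set G) (G ! i) (G ! j)))"

lemma bb_shape_add_vector:
  assumes "bb_shape (gens, prs, G)" "hom V" "lead_irreducible sigma_bar G V"
  shows "bb_shape (add_vector sigma_bar V (gens, prs, G))"
proof (cases "V = 0")
  case False
  have "finite {(i, length G) | i. i < length G \<and> snd (LT sigma_bar (G ! i)) = snd (LT sigma_bar V)}"
    by (rule finite_subset[of _ "{..<length G} \<times> {length G}"]) auto
  moreover have "\<not> term_dvd (LT sigma_bar (G ! i)) (LT sigma_bar V)" if "i < length G" for i
    using assms(1,3) that False nth_mem[OF that] by (auto simp: lead_irreducible_def bb_shape_def)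
  ultimately show ?thesis
    using assms(1,2) False
    by (fastforce simp: bb_shape_def add_vector_def nth_append less_Suc_eq)
qed (use assms in \<open>simp add: add_vector_def\<close>)

lemma bb_span_add_vector:
  fixes Q V :: "('k::field, 'm + 'n, 'r) fmod"
  assumes "deh Q - deh V \<in> fmod.span (deh ` set G)"
  shows "bb_span (add_vector sigma_bar V (gens, prs, G)) = bb_span (add_mset Q gens, prs, G)"
proof -
  let ?S = "deh ` (set_mset gens \<union> set G)"
  have "bb_span (add_vector sigma_bar V (gens, prs, G)) = fmod.span (insert (deh V) ?S)"
    by (cases "V = 0") (simp_all add: bb_span_def add_vector_def span_insert_redundant fmod.span_zero)
  also have "\<dots> = fmod.span (insert (deh Q) ?S)"
    using fmod.eq_span_insert_eq[of "deh Q" "deh V" ?S] assms fmod.span_mono[of "deh ` set G" ?S] by blast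
  finally show ?thesis by (simp add: bb_span_def)
qed

lemma bb_span_redundant:
  assumes "deh Q \<in> fmod.span (deh ` set G)"
  shows "bb_span (add_mset Q gens, prs, G) = bb_span (gens, prs', G)"
proof -
  have "deh Q \<in> fmod.span (deh ` (set_mset gens \<union> set G))"
    using assms fmod.span_mono[of "deh ` set G" "deh ` (set_mset gens \<union> set G)"] by blast
  then show ?thesis by (simp add: bb_span_def span_insert_redundant)
qed

lemma bb_pairs_add_vector:
  assumes mono: "\<And>S T U V. S \<subseteq> T \<Longrightarrow> \<Psi> S U V \<Longrightarrow> \<Psi> T U V"
    and pairs: "\<And>i j. i < j \<Longrightarrow> j < length G \<Longrightarrow> snd (LT sigma_bar (G ! i)) = snd (LT sigma_bar (G ! j)) \<Longrightarrow>
      (i, j) \<notin> prs \<Longrightarrow> \<Psi> (set G \<union> ({V} - {0})) (G ! i) (G ! j)"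
  shows "bb_pairs \<Psi> (add_vector sigma_bar V (gens, prs, G))"
  unfolding bb_pairs_def add_vector_def
  using pairs by (auto simp: nth_append less_Suc_eq)

text \<open>
  The two variants of the algorithm are instances: their remainders are weak saturating remainders,
  and they differ in the lifting condition \<open>\<Psi>\<close> that a treated pair satisfies.
\<close>

context
  fixes rem :: "('k::field, 'm + 'n, 'r) fmod list \<Rightarrow> ('k, 'm + 'n, 'r) fmod \<Rightarrow> ('k, 'm + 'n, 'r) fmod \<Rightarrow> bool"
    and \<Psi> :: "('k, 'm + 'n, 'r) fmod set \<Rightarrow> ('k, 'm + 'n, 'r) fmod \<Rightarrow> ('k, 'm + 'n, 'r) fmod \<Rightarrow> bool"
  assumes rem: "\<And>G Q V. \<forall>V\<in>set G. hom V \<Longrightarrow> hom Q \<Longrightarrow> rem G Q V \<Longrightarrow> weak_sat_remainder W \<delta> \<sigma> G Q V"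
    and \<Psi>_mono: "\<And>S T U V. S \<subseteq> T \<Longrightarrow> \<Psi> S U V \<Longrightarrow> \<Psi> T U V"
    and \<Psi>_rem: "\<And>G U V R. \<forall>V\<in>set G. hom V \<and> V \<noteq> 0 \<Longrightarrow> U \<in> set G \<Longrightarrow> V \<in> set G \<Longrightarrow>
      snd (LT sigma_bar U) = snd (LT sigma_bar V) \<Longrightarrow> rem G (S_vector sigma_bar U V) R \<Longrightarrow>
      \<Psi> (set G \<union> ({R} - {0})) U V"
begin

text \<open>
  The last claim drives termination: a round either extends \<open>\<G>\<close> or uses up a generator or a pair.
\<close>

lemma buchberger_step_invariant:
  assumes "buchberger_step sigma_bar rem s s'" "bb_shape s"
  shows "bb_shape s'" "bb_span s' = bb_span s" "bb_pairs \<Psi> s \<Longrightarrow> bb_pairs \<Psi> s'"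
    "snd (snd s') = snd (snd s) \<and>
       size (fst s') + card (fst (snd s')) < size (fst s) + card (fst (snd s)) \<or>
     (\<exists>V. snd (snd s') = snd (snd s) @ [V])"
proof -
  have "bb_shape s' \<and> bb_span s' = bb_span s \<and> (bb_pairs \<Psi> s \<longrightarrow> bb_pairs \<Psi> s') \<and>
    (snd (snd s') = snd (snd s) \<and>
       size (fst s') + card (fst (snd s')) < size (fst s) + card (fst (snd s)) \<or>
     (\<exists>V. snd (snd s') = snd (snd s) @ [V]))"
    using assms
  proof (induction rule: buchberger_step.induct)
    case (gens G Q V gens prs)
    have homG: "\<forall>V\<in>set G. hom V" and homQ: "hom Q" using gens(2) by (auto simp: bb_shape_def)
    have wk: "weak_sat_remainder W \<delta> \<sigma> G Q V" by (rule rem[OF homG homQ gens(1)])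
    then have steps: "(weak_sat_step W \<delta> \<sigma> G)\<^sup>*\<^sup>* Q V" and irr: "lead_irreducible sigma_bar G V"
      by (simp_all add: weak_sat_remainder_def)
    note V = weak_sat_steps(1,2)[OF steps homG homQ]
    have "bb_shape (gens, prs, G)" using gens(2) by (auto simp: bb_shape_def)
    then have "bb_shape (add_vector sigma_bar V (gens, prs, G))"
      using bb_shape_add_vector V(1) irr by blast
    moreover have "bb_pairs \<Psi> (add_vector sigma_bar V (gens, prs, G))" if "bb_pairs \<Psi> (add_mset Q gens, prs, G)"
    proof (rule bb_pairs_add_vector[OF \<Psi>_mono])
      fix i j assume "i < j" "j < length G"
        "snd (LT sigma_bar (G ! i)) = snd (LT sigma_bar (G ! j))" "(i, j) \<notin> prs"
      then have "\<Psi> (set G) (G ! i) (G ! j)" using that by (simp add: bb_pairs_def)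
      then show "\<Psi> (set G \<union> ({V} - {0})) (G ! i) (G ! j)" by (rule \<Psi>_mono[rotated]) blast
    qed
    ultimately show ?case using bb_span_add_vector[OF V(2)] by (simp add: add_vector_def)
  next
    case (pairs i j prs G V gens)
    have G: "\<forall>V\<in>set G. hom V \<and> V \<noteq> 0" and fin: "finite prs"
      and ij: "i < j" "j < length G" "snd (LT sigma_bar (G ! i)) = snd (LT sigma_bar (G ! j))"
      using pairs(1,3) by (auto simp: bb_shape_def)
    have mem: "G ! i \<in> set G" "G ! j \<in> set G" using ij by auto
    let ?Q = "S_vector sigma_bar (G ! i) (G ! j)"
    have homG: "\<forall>V\<in>set G. hom V" using G by blast
    have homQ: "hom ?Q" using G mem ij(3) by (intro homogeneous_S_vector[OF mo_bar]) auto
    have wk: "weak_sat_remainder W \<delta> \<sigma> G ?Q V" by (rule rem[OF homG homQ pairs(2)])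
    then have steps: "(weak_sat_step W \<delta> \<sigma> G)\<^sup>*\<^sup>* ?Q V" and irr: "lead_irreducible sigma_bar G V"
      by (simp_all add: weak_sat_remainder_def)
    note V = weak_sat_steps(1,2)[OF steps homG homQ]
    have "bb_shape (gens, prs - {(i, j)}, G)" using pairs(3) by (auto simp: bb_shape_def)
    then have "bb_shape (add_vector sigma_bar V (gens, prs - {(i, j)}, G))"
      using bb_shape_add_vector V(1) irr by blast
    moreover have "bb_span (add_vector sigma_bar V (gens, prs - {(i, j)}, G)) = bb_span (gens, prs, G)"
    proof -
      have "deh ?Q \<in> fmod.span (deh ` set G)"
        unfolding S_vector_def Let_def deh_diff deh_monomial_mult
        using mem by (intro fmod.span_diff fmod.span_scale fmod.span_base imageI)
      then show ?thesis using bb_span_add_vector[OF V(2)] bb_span_redundant by metis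
    qed
    moreover have "bb_pairs \<Psi> (add_vector sigma_bar V (gens, prs - {(i, j)}, G))" if "bb_pairs \<Psi> (gens, prs, G)"
    proof (rule bb_pairs_add_vector[OF \<Psi>_mono])
      fix i' j' assume h: "i' < j'" "j' < length G"
        "snd (LT sigma_bar (G ! i')) = snd (LT sigma_bar (G ! j'))" "(i', j') \<notin> prs - {(i, j)}"
      show "\<Psi> (set G \<union> ({V} - {0})) (G ! i') (G ! j')"
      proof (cases "(i', j') = (i, j)")
        case True
        then show ?thesis using \<Psi>_rem[OF G mem ij(3) pairs(2)] by simp
      next
        case False
        then have "\<Psi> (set G) (G ! i') (G ! j')" using that h by (auto simp: bb_pairs_def)
        then show ?thesis by (rule \<Psi>_mono[rotated]) blast
      qed
    qed
    moreover have "card (prs - {(i, j)}) < card prs" using fin pairs(1) by (intro card_Diff1_less)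
    ultimately show ?case by (simp add: add_vector_def)
  qed
  then show "bb_shape s'" "bb_span s' = bb_span s" "bb_pairs \<Psi> s \<Longrightarrow> bb_pairs \<Psi> s'"
    "snd (snd s') = snd (snd s) \<and>
       size (fst s') + card (fst (snd s')) < size (fst s) + card (fst (snd s)) \<or>
     (\<exists>V. snd (snd s') = snd (snd s) @ [V])" by blast+
qed

lemma buchberger_reaches_invariant:
  assumes "buchberger_reaches sigma_bar rem Us s" "\<forall>U\<in>set Us. hom U"
  shows "bb_shape s" "bb_span s = fmod.span (deh ` set Us)" "bb_pairs \<Psi> s"
proof -
  have "bb_shape s \<and> bb_span s = fmod.span (deh ` set Us) \<and> bb_pairs \<Psi> s"
    using assms(1) unfolding buchberger_reaches_def
  proof (induction rule: rtranclp_induct)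
    case base
    then show ?case using assms(2) by (simp add: bb_shape_def bb_span_def bb_pairs_def)
  next
    case (step s s')
    then show ?case using buchberger_step_invariant by blast
  qed
  then show "bb_shape s" "bb_span s = fmod.span (deh ` set Us)" "bb_pairs \<Psi> s" by blast+
qed

text \<open>
  Since rounds that leave \<open>\<G>\<close> unchanged use up generators and pairs, in an infinite run the tuple \<open>\<G>\<close>
  would grow without bound.  As it only grows at the end, its members would form one infinite
  sequence, whose leading terms contradict Dickson's lemma.
\<close>

lemma buchberger_terminates:
  assumes Us: "\<forall>U\<in>set Us. hom U"
  shows "\<nexists>f. f 0 = (mset Us, {}, []) \<and> (\<forall>k::nat. buchberger_step sigma_bar rem (f k) (f (Suc k)))"
proof
  assume "\<exists>f. f 0 = (mset Us, {}, []) \<and> (\<forall>k::nat. buchberger_step sigma_bar rem (f k) (f (Suc k)))"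
  then obtain f where f: "f 0 = (mset Us, {}, [])" "\<And>k::nat. buchberger_step sigma_bar rem (f k) (f (Suc k))"
    by blast
  have shape: "bb_shape (f k)" for k
  proof (induction k)
    case 0
    then show ?case using Us by (simp add: f(1) bb_shape_def)
  next
    case (Suc k)
    then show ?case using buchberger_step_invariant(1)[OF f(2)] by blast
  qed
  define G where "G k = snd (snd (f k))" for k
  define \<mu> where "\<mu> k = size (fst (f k)) + card (fst (snd (f k)))" for k
  have step: "G (Suc k) = G k \<and> \<mu> (Suc k) < \<mu> k \<or> (\<exists>V. G (Suc k) = G k @ [V])" for k
    unfolding G_def \<mu>_def using buchberger_step_invariant(4)[OF f(2) shape] .
  have prefix: "\<exists>H. G (k + d) = G k @ H" for k d
  proof (induction d)
    case (Suc d)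
    then show ?case using step[of "k + d"] by auto
  qed simp
  have nth_G: "G k ! i = G l ! i" if "i < length (G k)" "i < length (G l)" for i k l
  proof (cases "k \<le> l")
    case True
    then show ?thesis using prefix[of k "l - k"] that by (auto simp: nth_append)
  next
    case False
    then show ?thesis using prefix[of l "k - l"] that by (auto simp: nth_append)
  qed
  have growing: "\<exists>k. n < length (G k)" for n
  proof (induction n)
    case (Suc n)
    then obtain k where k: "n < length (G k)" by blast
    show ?case
    proof (rule ccontr)
      assume "\<not> ?thesis"
      then have bound: "length (G l) \<le> Suc n" for l by (meson not_le)
      have stable: "G (k + d) = G k" for d
      proof -
        obtain H where H: "G (k + d) = G k @ H" using prefix by blast
        have "length H = 0" using bound[of "k + d"] k unfolding H length_append by linarith
        then show ?thesis using H by simp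
      qed
      have "\<mu> (k + d) + d \<le> \<mu> k" for d
      proof (induction d)
        case (Suc d)
        have "G (Suc (k + d)) = G (k + d)" using stable[of d] stable[of "Suc d"] by simp
        then show ?case using step[of "k + d"] Suc by auto
      qed simp
      from this[of "Suc (\<mu> k)"] show False by simp
    qed
  next
    case 0
    show ?case
    proof (rule ccontr)
      assume "\<not> ?thesis"
      then have stable: "G l = []" for l by auto
      have "\<mu> d + d \<le> \<mu> 0" for d
      proof (induction d)
        case (Suc d)
        then show ?case using step[of d] stable[of "Suc d"] by auto
      qed simp
      from this[of "Suc (\<mu> 0)"] show False by simp
    qed
  qed
  then obtain k where k: "\<And>n. n < length (G (k n))" by metis
  obtain i j where ij: "i < j"
      "term_dvd (LT sigma_bar (G (k i) ! i)) (LT sigma_bar (G (k j) ! j))"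
    using Dickson[of UNIV "\<lambda>n. LT sigma_bar (G (k n) ! n)" "\<lambda>_. 0"] by auto
  have "i < length (G (k j))" using ij(1) k[of j] by simp
  then have "G (k i) ! i = G (k j) ! i" using nth_G k by blast
  then show False
    using shape[of "k j"] ij k[of j] unfolding bb_shape_def G_def by (auto split: prod.splits)
qed

lemma buchberger_computes_of_invariants:
  assumes Us: "\<forall>U\<in>set Us. hom U"
    and P: "\<And>G. bb_shape ({#}, {}, G) \<Longrightarrow> bb_span ({#}, {}, G) = fmod.span (deh ` set Us) \<Longrightarrow>
      bb_pairs \<Psi> ({#}, {}, G) \<Longrightarrow> P (set G)"
  shows "buchberger_computes sigma_bar rem Us P"
  unfolding buchberger_computes_def
proof (intro conjI allI impI)
  fix G assume "buchberger_reaches sigma_bar rem Us ({#}, {}, G)"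
  from buchberger_reaches_invariant[OF this Us] show "P (set G)" by (rule P)
qed (rule buchberger_terminates[OF Us])

end

section \<open>Correctness\<close>

lemma in_module_saturation:
  assumes "hom V" "deh V \<in> deh ` N"
  shows "V \<in> module_saturation W \<delta> N"
proof -
  obtain a where "V = Poly_Mapping.single a 1 *s homog W \<delta> (deh V)"
    using homogeneous_eq_y_saturation[OF assms(1)] unfolding saturation_def by blast
  moreover have "homog W \<delta> (deh V) \<in> homog W \<delta> ` deh ` N" using assms(2) by blast
  ultimately show ?thesis
    unfolding module_saturation_def homog_module_def using fmod.span_scale[OF fmod.span_base] by metis
qed

lemma S_pair_lifts_mono: "S \<subseteq> T \<Longrightarrow> S_pair_lifts \<sigma>' S U V \<Longrightarrow> S_pair_lifts \<sigma>' T U V"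
  unfolding S_pair_lifts_def by (rule lower_sums_mono)

text \<open>
  The S-vector of the dehomogenizations is the dehomogenization of the S-vector, so the weak
  saturating remainder already contains the required expression.
\<close>

lemma weak_sat_S_pair_lifts:
  fixes G :: "('k::field, 'm + 'n, 'r) fmod list"
  assumes G: "\<forall>V\<in>set G. hom V \<and> V \<noteq> 0" and UV: "U \<in> set G" "V \<in> set G"
    and comp: "snd (LT sigma_bar U) = snd (LT sigma_bar V)"
    and rem: "weak_sat_remainder W \<delta> \<sigma> G (S_vector sigma_bar U V) R"
  shows "S_pair_lifts \<sigma> (deh ` (set G \<union> ({R} - {0}))) (deh U) (deh V)"
proof -
  have U: "hom U" "U \<noteq> 0" and V: "hom V" "V \<noteq> 0" using G UV by auto
  have deh: "deh (S_vector sigma_bar U V) = S_vector \<sigma> (deh U) (deh V)"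
    by (rule deh_S_vector[OF mo U(1) V(1) U(2) V(2)])
  have "\<forall>u\<in>supp (deh (S_vector sigma_bar U V)).
      \<sigma> u (pp_lcm (fst (LT \<sigma> (deh U))) (fst (LT \<sigma> (deh V))), snd (LT \<sigma> (deh U)))"
    unfolding deh using comp LT_deh[OF mo U] LT_deh[OF mo V] by (intro ballI S_vector_below[OF mo]) simp_all
  from weak_sat_remainder_lower[OF rem _ _ this]
  show ?thesis
    unfolding S_pair_lifts_def deh
    using G homogeneous_S_vector[OF mo_bar U(1) V(1) U(2) V(2) comp] by blast
qed

lemma sat_S_pair_lifts:
  fixes G :: "('k::field, 'm + 'n, 'r) fmod list"
  assumes G: "\<forall>V\<in>set G. hom V \<and> V \<noteq> 0" and UV: "U \<in> set G" "V \<in> set G"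
    and comp: "snd (LT sigma_bar U) = snd (LT sigma_bar V)"
    and rem: "sat_remainder W \<delta> \<sigma> G (S_vector sigma_bar U V) R"
  shows "S_pair_lifts sigma_bar (set G \<union> ({R} - {0})) U V"
proof -
  have U: "hom U" "U \<noteq> 0" and V: "hom V" "V \<noteq> 0" using G UV by auto
  show ?thesis
    unfolding S_pair_lifts_def
  proof (rule sat_remainder_lower[OF rem])
    show "hom (S_vector sigma_bar U V)"
      by (rule homogeneous_S_vector[OF mo_bar U(1) V(1) U(2) V(2) comp])
  qed (use G S_vector_below[OF mo_bar U(2) V(2) comp] in auto)
qed

lemma DehomBasis_of_invariants:
  fixes Us :: "('k::field, 'm + 'n, 'r) fmod list"
  assumes inv: "bb_shape ({#}, {}, G)" "bb_span ({#}, {}, G) = fmod.span (deh ` set Us)"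
    "bb_pairs (\<lambda>S U V. S_pair_lifts \<sigma> (deh ` S) (deh U) (deh V)) ({#}, {}, G)"
  shows "DehomBasis W \<delta> \<sigma> (set G) (fmod.span (set Us))"
proof -
  have G: "hom V" "V \<noteq> 0" if "V \<in> set G" for V using inv(1) that by (auto simp: bb_shape_def)
  have span: "deh ` fmod.span (set Us) = fmod.span (set (map deh G))"
    using inv(2) by (simp add: bb_span_def deh_span)
  have "groebner_basis \<sigma> (set (map deh G)) (fmod.span (set (map deh G)))"
  proof (rule groebner_basis_of_S_pair_lifts[OF mo])
    show "0 \<notin> set (map deh G)" using LT_deh(3)[OF mo] G by force
    fix i j assume ij: "i < j" "j < length (map deh G)"
      "snd (LT \<sigma> (map deh G ! i)) = snd (LT \<sigma> (map deh G ! j))"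
    then have mem: "G ! i \<in> set G" "G ! j \<in> set G" by auto
    have "snd (LT sigma_bar (G ! i)) = snd (LT sigma_bar (G ! j))"
      using ij LT_deh(1)[OF mo G[OF mem(1)]] LT_deh(1)[OF mo G[OF mem(2)]] by simp
    then show "S_pair_lifts \<sigma> (set (map deh G)) (map deh G ! i) (map deh G ! j)"
      using inv(3) ij(1,2) by (simp add: bb_pairs_def)
  qed
  moreover have "V \<in> module_saturation W \<delta> (fmod.span (set Us))" if "V \<in> set G" for V
    by (rule in_module_saturation[OF G(1)[OF that]]) (use that span in \<open>auto intro: fmod.span_base\<close>)
  ultimately show ?thesis unfolding DehomBasis_def span using G by auto
qed

text \<open>
  The witness for the graded module in the definition is the module generated by \<open>\<G>\<close>.
\<close>

lemma SatGBasis_of_invariants: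
  fixes Us :: "('k::field, 'm + 'n, 'r) fmod list"
  assumes inv: "bb_shape ({#}, {}, G)" "bb_span ({#}, {}, G) = fmod.span (deh ` set Us)"
    "bb_pairs (S_pair_lifts sigma_bar) ({#}, {}, G)"
  shows "SatGBasis W \<delta> \<sigma> (set G) (fmod.span (set Us))"
proof -
  have G: "hom V" "V \<noteq> 0" if "V \<in> set G" for V using inv(1) that by (auto simp: bb_shape_def)
  have span: "deh ` fmod.span (set Us) = deh ` fmod.span (set G)"
    using inv(2) by (simp add: bb_span_def deh_span)
  have "groebner_basis sigma_bar (set G) (fmod.span (set G))"
    using inv(3) G by (intro groebner_basis_of_S_pair_lifts[OF mo_bar]) (auto simp: bb_pairs_def)
  moreover have "graded_submodule (ext_matrix W) \<delta> (fmod.span (set G))"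
    using G by (intro graded_submodule_span) blast
  moreover have "module_saturation W \<delta> (fmod.span (set G)) = module_saturation W \<delta> (fmod.span (set Us))"
    by (simp add: module_saturation_def span)
  moreover have "V \<in> module_saturation W \<delta> (fmod.span (set Us))" if "V \<in> set G" for V
    by (rule in_module_saturation[OF G(1)[OF that]]) (use that span in \<open>auto intro: fmod.span_base\<close>)
  ultimately show ?thesis unfolding SatGBasis_def using G by blast
qed

lemma weak_saturating_Buchberger_computes:
  fixes Us :: "('k::field, 'm + 'n, 'r) fmod list"
  assumes Us: "\<forall>U\<in>set Us. hom U"
  shows "buchberger_computes sigma_bar (weak_sat_remainder W \<delta> \<sigma>) Us
    (\<lambda>G. DehomBasis W \<delta> \<sigma> G (fmod.span (set Us)))"
proof (rule buchberger_computes_of_invariants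
    [where \<Psi> = "\<lambda>S U V. S_pair_lifts \<sigma> (deh ` S) (deh U) (deh V)", OF _ _ _ Us])
  show "S_pair_lifts \<sigma> (deh ` T) (deh U) (deh V)"
    if "S \<subseteq> T" "S_pair_lifts \<sigma> (deh ` S) (deh U) (deh V)"
    for S T and U V :: "('k, 'm + 'n, 'r) fmod"
    by (rule S_pair_lifts_mono[OF image_mono[OF that(1)] that(2)])
qed (fact weak_sat_S_pair_lifts DehomBasis_of_invariants | assumption)+

lemma saturating_Buchberger_computes:
  fixes Us :: "('k::field, 'm + 'n, 'r) fmod list"
  assumes Us: "\<forall>U\<in>set Us. hom U"
  shows "buchberger_computes sigma_bar (sat_remainder W \<delta> \<sigma>) Us
    (\<lambda>G. SatGBasis W \<delta> \<sigma> G (fmod.span (set Us)))"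
  by (rule buchberger_computes_of_invariants[where \<Psi> = "S_pair_lifts sigma_bar", OF _ _ _ Us])
    (fact sat_remainder_imp_weak S_pair_lifts_mono sat_S_pair_lifts SatGBasis_of_invariants |
     rule sat_remainder_imp_weak; assumption)+

lemma buchberger_progress_if_remainders_exist:
  fixes Us :: "('k::field, 'm + 'n, 'r) fmod list"
  assumes rem: "\<And>G Q V. \<forall>V\<in>set G. hom V \<Longrightarrow> hom Q \<Longrightarrow> rem G Q V \<Longrightarrow> weak_sat_remainder W \<delta> \<sigma> G Q V"
    and ex: "\<And>G Q. \<forall>V\<in>set G. hom V \<Longrightarrow> hom Q \<Longrightarrow> \<exists>V. rem G Q V"
    and Us: "\<forall>U\<in>set Us. hom U"
  shows "buchberger_progress sigma_bar rem Us"
  unfolding buchberger_progress_def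
proof (intro allI impI)
  fix gens prs G assume "buchberger_reaches sigma_bar rem Us (gens, prs, G)"
  then have shape: "bb_shape (gens, prs, G)"
    using buchberger_reaches_invariant(1)[of rem "\<lambda>_ _ _. True"] rem Us by blast
  then have G: "\<forall>V\<in>set G. hom V \<and> V \<noteq> 0" and gens: "\<forall>Q\<in>#gens. hom Q" by (auto simp: bb_shape_def)
  have "\<exists>V. rem G (S_vector sigma_bar (G ! i) (G ! j)) V" if "(i, j) \<in> prs" for i j
  proof -
    have ij: "i < j" "j < length G" "snd (LT sigma_bar (G ! i)) = snd (LT sigma_bar (G ! j))"
      using shape that by (auto simp: bb_shape_def)
    then have mem: "G ! i \<in> set G" "G ! j \<in> set G" by auto
    have "hom (S_vector sigma_bar (G ! i) (G ! j))"
      using G mem ij(3) by (intro homogeneous_S_vector[OF mo_bar]) auto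
    then show ?thesis using ex G by blast
  qed
  then show "(\<forall>Q\<in>#gens. \<exists>V. rem G Q V) \<and>
      (\<forall>(i, j)\<in>prs. \<exists>V. rem G (S_vector sigma_bar (G ! i) (G ! j)) V)"
    using ex G gens by blast
qed

lemma saturating_Buchberger_progress:
  fixes Us :: "('k::field, 'm + 'n, 'r) fmod list"
  assumes wf: "wfp \<sigma>" and Us: "\<forall>U\<in>set Us. hom U"
  shows "buchberger_progress sigma_bar (weak_sat_remainder W \<delta> \<sigma>) Us"
    and "buchberger_progress sigma_bar (sat_remainder W \<delta> \<sigma>) Us"
proof -
  have ex: "\<exists>V. sat_remainder W \<delta> \<sigma> G Q V" if "\<forall>V\<in>set G. hom V" "hom Q"
    for G and Q :: "('k, 'm + 'n, 'r) fmod"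
    using remainder_exists[OF wf that] unfolding sat_remainder_def by blast
  show "buchberger_progress sigma_bar (weak_sat_remainder W \<delta> \<sigma>) Us"
    by (rule buchberger_progress_if_remainders_exist[OF _ _ Us]) (use ex sat_remainder_imp_weak in blast)+
  show "buchberger_progress sigma_bar (sat_remainder W \<delta> \<sigma>) Us"
    by (rule buchberger_progress_if_remainders_exist[OF _ _ Us]) (use ex sat_remainder_imp_weak in blast)+
qed

end

theorem theorem19:
  fixes W :: "('m::{finite,linorder}, 'n::finite) zmat"
    and \<delta> :: "'r::finite \<Rightarrow> 'm zvec"
    and \<sigma> :: "('n, 'r) trm \<Rightarrow> ('n, 'r) trm \<Rightarrow> bool"
    and Us :: "('k::field, 'm + 'n, 'r) fmod list"
    and N :: "('k, 'm + 'n, 'r) fmod set"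
  assumes rank_W: "rank (\<chi> i j. rat_of_int (W $ i $ j)) = CARD('m)"
    and \<sigma>: "module_ordering \<sigma>"
    and Us: "\<forall>U\<in>set Us. homogeneous (ext_matrix W) \<delta> U"
    and N: "N = fmod.span (set Us)"
  shows "buchberger_computes (ext_ordering W \<delta> \<sigma>) (weak_sat_remainder W \<delta> \<sigma>) Us
           (\<lambda>G. DehomBasis W \<delta> \<sigma> G N)
       \<and> buchberger_computes (ext_ordering W \<delta> \<sigma>) (sat_remainder W \<delta> \<sigma>) Us
           (\<lambda>G. SatGBasis W \<delta> \<sigma> G N)
       \<and> (wfp \<sigma> \<longrightarrow>
           buchberger_progress (ext_ordering W \<delta> \<sigma>) (weak_sat_remainder W \<delta> \<sigma>) Us \<and>
           buchberger_progress (ext_ordering W \<delta> \<sigma>) (sat_remainder W \<delta> \<sigma>) Us)"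
  unfolding N
  using weak_saturating_Buchberger_computes[OF \<sigma> Us] saturating_Buchberger_computes[OF \<sigma> Us]
    saturating_Buchberger_progress[OF \<sigma> _ Us] by (intro conjI impI)

end
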